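(* Let $n>k>t$ be positive integers with $n\geq 4(t+2)^2k^2$ and $k\geq 5$. Suppose that $\mathcal{F},\mathcal{G}\subset\binom{[n]}{k}$ are non-trivial cross $t$-intersecting families. Then \[ |\mathcal{F}||\mathcal{G}|\leq \max\left\{|\mathcal{A}(n,k,t)|^2,\ |\mathcal{H}(n,k,t)|^2\right\}. \]
   Context: $[n]=\{1,\dots,n\}$ and $\binom{[n]}{k}$ is the family of all $k$-element subsets of $[n]$; $[a,b]=\{a,a+1,\dots,b\}$. Two families $\mathcal{F},\mathcal{G}\subset\binom{[n]}{k}$ are cross $t$-intersecting if $|F\cap G|\geq t$ for all $F\in\mathcal{F},G\in\mathcal{G}$; they are non-trivial cross $t$-intersecting if moreover $|\bigcap\{F\colon F\in\mathcal{F}\}|<t$ and $|\bigcap\{G\colon G\in\mathcal{G}\}|<t$. Define $\mathcal{H}(n,k,t)=\{H\in\binom{[n]}{k}\colon [t]\subset H,\ H\cap[t+1,k+1]\neq\emptyset\}\cup\{[k+1]\setminus\{j\}\colon 1\leq j\leq t\}$ and $\mathcal{A}(n,k,t)=\{A\in\binom{[n]}{k}\colon |A\cap[t+2]|\geq t+1\}$. *)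

theory Defs
  imports Complex_Main "HOL-Library.Ramsey"
begin

definition cross_intersecting :: "nat \<Rightarrow> nat set set \<Rightarrow> nat set set \<Rightarrow> bool" where
  "cross_intersecting t \<F> \<G> \<longleftrightarrow> (\<forall>F\<in>\<F>. \<forall>G\<in>\<G>. card (F \<inter> G) \<ge> t)"

text \<open>
  The common intersection is taken inside the ground set \<open>{1..n}\<close>. For a non-empty family of
  subsets of \<open>{1..n}\<close> this changes nothing; for the empty family it gives \<open>{1..n}\<close> rather
  than the infinite set \<^term>\<open>UNIV :: nat set\<close>, whose \<^const>\<open>card\<close> would be \<open>0\<close>.
\<close>

definition nontrivial_cross_intersecting ::
    "nat \<Rightarrow> nat \<Rightarrow> nat set set \<Rightarrow> nat set set \<Rightarrow> bool" where
  "nontrivial_cross_intersecting n t \<F> \<G> \<longleftrightarrow>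
     cross_intersecting t \<F> \<G> \<and>
     card ({1..n} \<inter> \<Inter>\<F>) < t \<and> card ({1..n} \<inter> \<Inter>\<G>) < t"

definition \<H> :: "nat \<Rightarrow> nat \<Rightarrow> nat \<Rightarrow> nat set set" where
  "\<H> n k t = {H \<in> nsets {1..n} k. {1..t} \<subseteq> H \<and> H \<inter> {t+1..k+1} \<noteq> {}}
             \<union> {{1..k+1} - {j} | j. 1 \<le> j \<and> j \<le> t}"

definition \<A> :: "nat \<Rightarrow> nat \<Rightarrow> nat \<Rightarrow> nat set set" where
  "\<A> n k t = {A \<in> nsets {1..n} k. card (A \<inter> {1..t+2}) \<ge> t + 1}"

end

theory Submission
  imports Defs
begin

text \<open>
  Saturate both families, so that each consists of all \<open>k\<close>-sets meeting every member of the
  other in at least \<open>t\<close> elements. Let \<open>t + a\<close> and \<open>t + b\<close> be the minimal sizes of sets meeting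
  every member of \<open>\<F>\<close>, respectively \<open>\<G>\<close>, in at least \<open>t\<close> elements; non-triviality means
  \<open>a, b \<ge> 1\<close>. A member of \<open>\<F>\<close> contains a \<open>t\<close>-subset of a minimal transversal of \<open>\<F>\<close>, and from
  there it can be found by \<open>b\<close> branchings with \<open>m = k - t + 1\<close> choices each. Writing \<open>N u\<close> for
  the number of \<open>k\<close>-sets above a given \<open>u\<close>-set, this gives
  \<open>|\<F>| |\<G>| \<le> \<phi> a * \<phi> b\<close> with the rapidly decreasing \<open>\<phi> a = (t + a choose t) m^a N (t + a)\<close>.

  By symmetry only \<open>(a, b) = (1, 1)\<close> and \<open>(1, 2)\<close> survive this estimate. There \<open>|\<F>|\<close> is, up to a small
  error, \<open>N (t + 1)\<close> times the number of \<open>(t + 1)\<close>-sets that are transversals of \<open>\<G>\<close>, and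
  these \<open>(t + 1)\<close>-sets cross \<open>t\<close>-intersect the \<open>(t + 1)\<close>-sets that are transversals of \<open>\<F>\<close>.
  If both collections have at least three elements, either they all lie in one
  \<open>(t + 2)\<close>-set, which forces a copy of \<open>\<A> n k t\<close>, or they share a \<open>t\<close>-element core,
  which is compared exactly with \<open>\<H> n k t\<close>, or the product is too small.
\<close>

section \<open>Counting sets above a family\<close>

lemma card_nsets_between:
  assumes "finite V" "D \<subseteq> V" "Z \<subseteq> V" "D \<inter> Z = {}" "card D \<le> k"
  shows "card {K \<in> nsets V k. D \<subseteq> K \<and> K \<inter> Z = {}} = (card V - card D - card Z) choose (k - card D)"
proof -
  have fD: "finite D" "finite Z" using assms finite_subset by blast+
  have "bij_betw (\<lambda>K. K - D) {K \<in> nsets V k. D \<subseteq> K \<and> K \<inter> Z = {}}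
          {L. L \<subseteq> V - D - Z \<and> card L = k - card D}"
  proof (rule bij_betw_byWitness[where f' = "\<lambda>L. L \<union> D"])
    show "\<forall>K\<in>{K \<in> nsets V k. D \<subseteq> K \<and> K \<inter> Z = {}}. K - D \<union> D = K" by auto
    show "\<forall>L\<in>{L. L \<subseteq> V - D - Z \<and> card L = k - card D}. L \<union> D - D = L" by auto
    show "(\<lambda>K. K - D) ` {K \<in> nsets V k. D \<subseteq> K \<and> K \<inter> Z = {}}
        \<subseteq> {L. L \<subseteq> V - D - Z \<and> card L = k - card D}"
      using fD by (auto simp: nsets_def card_Diff_subset)
    show "(\<lambda>L. L \<union> D) ` {L. L \<subseteq> V - D - Z \<and> card L = k - card D}
        \<subseteq> {K \<in> nsets V k. D \<subseteq> K \<and> K \<inter> Z = {}}"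
    proof clarify
      fix L assume L: "L \<subseteq> V - D - Z" "card L = k - card D"
      have "finite L" using L(1) assms(1) by (meson finite_Diff finite_subset)
      then have "card (L \<union> D) = k"
        using L fD assms(5) by (subst card_Un_disjoint) auto
      then show "L \<union> D \<in> nsets V k \<and> D \<subseteq> L \<union> D \<and> (L \<union> D) \<inter> Z = {}"
        using L assms \<open>finite L\<close> fD by (auto simp: nsets_def)
    qed
  qed
  then have "card {K \<in> nsets V k. D \<subseteq> K \<and> K \<inter> Z = {}} = card {L. L \<subseteq> V - D - Z \<and> card L = k - card D}"
    by (rule bij_betw_same_card)
  also have "\<dots> = card (V - D - Z) choose (k - card D)"
    using assms(1) by (simp add: n_subsets)
  also have "card (V - D - Z) = card V - card D - card Z"
  proof -
    have "Z \<subseteq> V - D" using assms by auto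
    then show ?thesis using fD assms by (simp add: card_Diff_subset)
  qed
  finally show ?thesis .
qed

text \<open>Sort the sets \<open>K\<close> by what they omit from \<open>W\<close>: exactly one
  element, or none. These cases are disjoint, and the resulting count depends only on the size of
  \<open>W\<close>; this later allows \<open>{1..t+2}\<close> in \<open>\<A> n k t\<close> to be
  replaced by any other \<open>(t + 2)\<close>-set.\<close>

lemma card_nsets_near_all:
  assumes "finite V" "W \<subseteq> V" "card W = Suc r" "r \<le> k"
  shows "card {K \<in> nsets V k. card (K \<inter> W) \<ge> r}
    = Suc r * ((card V - Suc r) choose (k - r)) + card {K \<in> nsets V k. W \<subseteq> K}"
proof -
  have fW: "finite W" using assms finite_subset by blast
  have fin: "finite (nsets V k)" using assms(1) by (rule finite_imp_finite_nsets)
  define P where "P w = {K \<in> nsets V k. W - {w} \<subseteq> K \<and> K \<inter> {w} = {}}" for w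
  have cP: "card (P w) = (card V - Suc r) choose (k - r)" if "w \<in> W" for w
  proof -
    have "card (W - {w}) = r" using that assms(3) fW by simp
    then show ?thesis
      unfolding P_def using card_nsets_between[OF assms(1), of "W - {w}" "{w}" k] that assms by auto
  qed
  have eq: "{K \<in> nsets V k. card (K \<inter> W) \<ge> r} = (\<Union>w\<in>W. P w) \<union> {K \<in> nsets V k. W \<subseteq> K}"
  proof (intro equalityI subsetI)
    fix K assume K: "K \<in> {K \<in> nsets V k. card (K \<inter> W) \<ge> r}"
    show "K \<in> (\<Union>w\<in>W. P w) \<union> {K \<in> nsets V k. W \<subseteq> K}"
    proof (cases "W \<subseteq> K")
      case False
      then obtain w where w: "w \<in> W" "w \<notin> K" by auto
      then have "K \<inter> W \<subseteq> W - {w}" by auto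
      moreover have "card (W - {w}) = r" using w assms(3) fW by simp
      ultimately have "K \<inter> W = W - {w}"
        using K fW by (intro card_seteq) auto
      then show ?thesis using w K unfolding P_def by auto
    qed (use K in auto)
  next
    fix K assume K: "K \<in> (\<Union>w\<in>W. P w) \<union> {K \<in> nsets V k. W \<subseteq> K}"
    show "K \<in> {K \<in> nsets V k. card (K \<inter> W) \<ge> r}"
    proof (cases "W \<subseteq> K")
      case True
      then have "K \<inter> W = W" by auto
      then show ?thesis using K assms(3) unfolding P_def by auto
    next
      case False
      then obtain w where w: "w \<in> W" "K \<in> P w" using K by auto
      then have "W - {w} \<subseteq> K \<inter> W" unfolding P_def by auto
      then have "card (W - {w}) \<le> card (K \<inter> W)" using fW by (intro card_mono) auto
      then show ?thesis using w assms(3) fW unfolding P_def by auto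
    qed
  qed
  have "card (\<Union>w\<in>W. P w) = (\<Sum>w\<in>W. card (P w))"
  proof (rule card_UN_disjoint)
    show "\<forall>w\<in>W. finite (P w)" using fin unfolding P_def by simp
    show "\<forall>i\<in>W. \<forall>j\<in>W. i \<noteq> j \<longrightarrow> P i \<inter> P j = {}" unfolding P_def by auto
  qed (rule fW)
  also have "\<dots> = Suc r * ((card V - Suc r) choose (k - r))"
    using cP assms(3) by simp
  finally have 1: "card (\<Union>w\<in>W. P w) = Suc r * ((card V - Suc r) choose (k - r))" .
  have "(\<Union>w\<in>W. P w) \<inter> {K \<in> nsets V k. W \<subseteq> K} = {}" unfolding P_def by auto
  moreover have "finite (\<Union>w\<in>W. P w)" using fin fW unfolding P_def by auto
  ultimately show ?thesis unfolding eq using 1 fin by (subst card_Un_disjoint) auto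
qed

section \<open>Parameters, and the number of \<open>k\<close>-sets above a given set\<close>

locale cross_params =
  fixes n k t :: nat
  assumes t_pos: "0 < t" and t_less: "t < k" and n_large: "4 * (t + 2)^2 * k^2 \<le> n" and k_ge: "5 \<le> k"
begin

text \<open>Besides being the number of choices in a branching step, this is the size of
  \<open>{t+1..k+1}\<close>; hence branching bounds can be compared with
  \<open>\<H> n k t\<close>.\<close>

definition m :: nat where "m = k - t + 1"

definition V :: "nat set" where "V = {1..n}"

lemma finite_V [simp]: "finite V" and card_V [simp]: "card V = n"
  by (simp_all add: V_def)

text \<open>The guard matters: for \<open>u > k\<close> the truncated difference
  \<open>k - u\<close> is 0, and the binomial coefficient would be 1 although no
  \<open>k\<close>-set lies above a \<open>u\<close>-set.\<close>

definition N :: "nat \<Rightarrow> nat" where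
  "N u = (if u \<le> k then (n - u) choose (k - u) else 0)"

lemma m_t: "m + t = k + 1" and m_le: "m \<le> k"
  using t_less t_pos unfolding m_def by auto

lemma n_ge: "36 * k^2 \<le> n"
proof -
  have "3^2 \<le> (t + 2)^2" using t_pos by (intro power_mono) auto
  then have "36 * k^2 \<le> 4 * (t+2)^2 * k^2" by (intro mult_right_mono) auto
  then show ?thesis using n_large by linarith
qed

lemma n_gt: "4 * k + 4 < n"
proof -
  have "5 * k \<le> k^2" using k_ge by (simp add: power2_eq_square)
  then show ?thesis using n_ge k_ge by linarith
qed

lemma card_above:
  assumes "U \<subseteq> V"
  shows "card {K \<in> nsets V k. U \<subseteq> K} = N (card U)"
proof (cases "card U \<le> k")
  case True
  then show ?thesis
    using card_nsets_between[of V U "{}" k] assms by (simp add: N_def)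
next
  case False
  have "{K \<in> nsets V k. U \<subseteq> K} = {}"
    using False by (auto simp: nsets_def dest: card_mono)
  then show ?thesis using False by (simp only: N_def card.empty if_False)
qed

lemma N_step: "N (Suc u) * (n - u) = N u * (k - u)"
proof (cases "u < k")
  case True
  then show ?thesis
    using times_binomial_minus1_eq[of "k - u" "n - u"] by (simp add: N_def Suc_diff_le mult.commute)
next
  case False
  then show ?thesis by (auto simp: N_def)
qed

text \<open>By \<open>N_step\<close> the ratio of consecutive values is
  \<open>(k - u) / (n - u)\<close>, at most \<open>k / n\<close>, and \<open>n_large\<close> bounds
  this by \<open>1 / (4 * (t + 2)^2 * k)\<close>. The error estimates below rest on this
  decay.\<close>

lemma N_decay: "N (Suc u) * (4 * (t + 2)^2 * k) \<le> N u"
proof (cases "u < k")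
  case True
  have "n * (k - u) \<le> (n - u) * k"
  proof -
    have "u * k \<le> n * u" using n_gt by (simp add: mult.commute)
    then show ?thesis unfolding diff_mult_distrib diff_mult_distrib2 by (rule diff_le_mono2)
  qed
  then have "N (Suc u) * (n * (k - u)) \<le> N (Suc u) * ((n - u) * k)" by (rule mult_le_mono2)
  also have "\<dots> = N u * (k - u) * k" using N_step[of u] by (metis mult.assoc)
  finally have "(k - u) * (N (Suc u) * n) \<le> (k - u) * (N u * k)" by (simp add: ac_simps)
  then have 1: "N (Suc u) * n \<le> N u * k" using True by simp
  have "(N (Suc u) * (4 * (t + 2)^2 * k)) * k \<le> N (Suc u) * n"
    using mult_le_mono2[OF n_large, of "N (Suc u)"] by (simp add: power2_eq_square ac_simps)
  also note 1
  finally show ?thesis using True by simp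
next
  case False
  then show ?thesis by (simp add: N_def)
qed

lemma N_antimono: "N (Suc u) \<le> N u"
proof -
  have "1 \<le> 4 * (t + 2)^2 * k" using k_ge by simp
  then have "N (Suc u) * 1 \<le> N (Suc u) * (4 * (t + 2)^2 * k)" by (rule mult_le_mono2)
  then show ?thesis using N_decay[of u] by linarith
qed

lemma N_mono_le: "u \<le> v \<Longrightarrow> N v \<le> N u"
  using N_antimono by (rule lift_Suc_antimono_le)

lemma N_k: "N k = 1" by (simp add: N_def)

text \<open>The new set \<open>W\<^sub>0\<close> contributes \<open>N r\<close> sets, except those
  already counted. A set counted twice contains \<open>W \<union> W\<^sub>0\<close> for some
  \<open>W \<in> \<W>\<close>, and this union has at least \<open>r + 1\<close> elements.\<close>

lemma card_up_insert:
  assumes "finite \<W>" "\<And>W. W \<in> insert W\<^sub>0 \<W> \<Longrightarrow> W \<subseteq> V \<and> card W = r" "W\<^sub>0 \<notin> \<W>"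
  shows "card {K \<in> nsets V k. \<exists>W\<in>\<W>. W \<subseteq> K} + N r
    \<le> card {K \<in> nsets V k. \<exists>W\<in>insert W\<^sub>0 \<W>. W \<subseteq> K} + card \<W> * N (Suc r)"
proof -
  let ?K = "nsets V k"
  have fin: "finite ?K" by (simp add: finite_imp_finite_nsets)
  let ?A = "{K \<in> ?K. \<exists>W\<in>\<W>. W \<subseteq> K}" and ?B = "{K \<in> ?K. W\<^sub>0 \<subseteq> K}"
  have U: "{K \<in> ?K. \<exists>W\<in>insert W\<^sub>0 \<W>. W \<subseteq> K} = ?A \<union> ?B" by auto
  have "?A \<inter> ?B \<subseteq> (\<Union>W\<in>\<W>. {K \<in> ?K. W \<union> W\<^sub>0 \<subseteq> K})" by auto
  then have "card (?A \<inter> ?B) \<le> card (\<Union>W\<in>\<W>. {K \<in> ?K. W \<union> W\<^sub>0 \<subseteq> K})"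
    using assms(1) fin by (intro card_mono) auto
  also have "\<dots> \<le> (\<Sum>W\<in>\<W>. card {K \<in> ?K. W \<union> W\<^sub>0 \<subseteq> K})" using assms(1) by (rule card_UN_le)
  also have "\<dots> \<le> (\<Sum>W\<in>\<W>. N (Suc r))"
  proof (rule sum_mono)
    fix W assume W: "W \<in> \<W>"
    then have *: "W \<subseteq> V" "card W = r" "W\<^sub>0 \<subseteq> V" "card W\<^sub>0 = r" using assms(2) by auto
    then have f: "finite W" "finite W\<^sub>0" by (auto intro: finite_subset)
    have "W \<noteq> W\<^sub>0" using W assms(3) by auto
    then have "W \<subset> W \<union> W\<^sub>0" using * f by (metis Un_upper1 Un_upper2 card_subset_eq psubsetI)
    then have "Suc r \<le> card (W \<union> W\<^sub>0)" using f * by (metis Suc_leI finite_UnI psubset_card_mono)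
    then show "card {K \<in> ?K. W \<union> W\<^sub>0 \<subseteq> K} \<le> N (Suc r)"
      using card_above[of "W \<union> W\<^sub>0"] * by (simp add: N_mono_le)
  qed
  finally have "card (?A \<inter> ?B) \<le> card \<W> * N (Suc r)" by simp
  moreover have "card ?A + card ?B = card (?A \<union> ?B) + card (?A \<inter> ?B)"
    using fin by (intro card_Un_Int) auto
  moreover have "card ?B = N r" using card_above assms(2) by auto
  ultimately show ?thesis unfolding U by linarith
qed

text \<open>Iterates \<open>card_up_insert\<close> over \<open>\<Y>\<close>, with \<open>q\<close>
  bounding the size of every intermediate family. With \<open>\<X>\<close> empty this is a
  Bonferroni inequality; the general form measures the loss when the generators in
  \<open>\<Y>\<close> are dropped.\<close>

lemma card_up_union:
  assumes "finite \<X>" "finite \<Y>" "\<X> \<inter> \<Y> = {}"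
    and "\<And>W. W \<in> \<X> \<union> \<Y> \<Longrightarrow> W \<subseteq> V \<and> card W = r" and "card \<X> + card \<Y> \<le> q"
  shows "card {K \<in> nsets V k. \<exists>W\<in>\<X>. W \<subseteq> K} + card \<Y> * N r
    \<le> card {K \<in> nsets V k. \<exists>W\<in>\<X> \<union> \<Y>. W \<subseteq> K} + card \<Y> * (q * N (Suc r))"
  using assms(2,3,4,5)
proof (induction \<Y> rule: finite_induct)
  case empty
  then show ?case by simp
next
  case (insert W \<Y>)
  have IH: "card {K \<in> nsets V k. \<exists>W\<in>\<X>. W \<subseteq> K} + card \<Y> * N r
    \<le> card {K \<in> nsets V k. \<exists>W\<in>\<X> \<union> \<Y>. W \<subseteq> K} + card \<Y> * (q * N (Suc r))"
    using insert by (intro insert.IH) auto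
  have "card {K \<in> nsets V k. \<exists>W\<in>\<X> \<union> \<Y>. W \<subseteq> K} + N r
    \<le> card {K \<in> nsets V k. \<exists>W\<in>insert W (\<X> \<union> \<Y>). W \<subseteq> K} + card (\<X> \<union> \<Y>) * N (Suc r)"
    using insert assms(1) by (intro card_up_insert) auto
  moreover have "card (\<X> \<union> \<Y>) * N (Suc r) \<le> q * N (Suc r)"
    using insert card_Un_le[of \<X> \<Y>] by (intro mult_le_mono1) auto
  moreover have "card (insert W \<Y>) = Suc (card \<Y>)" using insert by simp
  ultimately show ?case using IH unfolding Un_insert_right by (simp only: mult_Suc)
qed

lemma card_up_ge:
  assumes "finite \<W>" "\<And>W. W \<in> \<W> \<Longrightarrow> W \<subseteq> V \<and> card W = r"
  shows "card \<W> * N r \<le> card {K \<in> nsets V k. \<exists>W\<in>\<W>. W \<subseteq> K} + card \<W> * (card \<W> * N (Suc r))"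
  using card_up_union[of "{}" \<W> r "card \<W>"] assms by simp

section \<open>Transversals and branching\<close>

lemma finite_subset_V: "U \<subseteq> V \<Longrightarrow> finite U"
  using finite_subset finite_V by blast

definition transv :: "nat set set \<Rightarrow> nat set \<Rightarrow> bool" where
  "transv \<G> U \<longleftrightarrow> U \<subseteq> V \<and> (\<forall>G\<in>\<G>. t \<le> card (U \<inter> G))"

text \<open>For a non-trivial pair no set of size \<open>t\<close> is a transversal, so these are
  the transversals of the least conceivable size.\<close>

definition base :: "nat set set \<Rightarrow> nat set set" where
  "base \<G> = {T. transv \<G> T \<and> card T = t + 1}"

lemma transv_mono: "transv \<G> U \<Longrightarrow> U \<subseteq> U' \<Longrightarrow> U' \<subseteq> V \<Longrightarrow> transv \<G> U'"
  unfolding transv_def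
  by (meson Int_mono card_mono finite_Int finite_V le_trans order_refl rev_finite_subset)

lemma finite_base [simp]: "finite (base \<G>)"
  by (rule finite_subset[of _ "Pow V"]) (auto simp: base_def transv_def)

lemma baseD: "T \<in> base \<G> \<Longrightarrow> T \<subseteq> V \<and> finite T \<and> card T = t + 1 \<and> transv \<G> T"
  unfolding base_def transv_def using finite_subset[OF _ finite_V] by auto

text \<open>If \<open>U\<close> meets some \<open>G\<close> in \<open>t - j\<close> elements, a transversal above \<open>U\<close> has at least
  \<open>j\<close> of the \<open>k - t + j\<close> elements of \<open>G - U\<close>, so it hits each set of \<open>m = k - t + 1\<close> of them.\<close>

lemma hitting_set:
  assumes "\<G> \<subseteq> nsets V k" "U \<subseteq> V" "\<not> transv \<G> U"
  shows "\<exists>X. X \<subseteq> V \<and> card X = m \<and> X \<inter> U = {} \<and> (\<forall>K. transv \<G> K \<longrightarrow> U \<subseteq> K \<longrightarrow> K \<inter> X \<noteq> {})"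
proof -
  obtain G where G: "G \<in> \<G>" "card (U \<inter> G) < t"
    using assms unfolding transv_def by force
  then have Gk: "G \<subseteq> V" "finite G" "card G = k" using assms(1) by (auto simp: nsets_def)
  have "card (G - U) = k - card (U \<inter> G)"
    using Gk by (simp add: card_Diff_subset_Int Int_commute)
  then have "m \<le> card (G - U)" using G(2) t_less unfolding m_def by linarith
  then obtain X where X: "X \<subseteq> G - U" "card X = m"
    by (meson obtain_subset_with_card_n)
  have "K \<inter> X \<noteq> {}" if K: "transv \<G> K" for K
  proof
    assume e: "K \<inter> X = {}"
    have "t \<le> card (K \<inter> G)" using K G(1) unfolding transv_def by auto
    also have "card (K \<inter> G) \<le> card (G - X)" using e Gk by (intro card_mono) auto
    also have "card (G - X) = k - m"
      using X Gk finite_subset[of X G] by (subst card_Diff_subset) auto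
    finally show False using t_less t_pos unfolding m_def by linarith
  qed
  then show ?thesis using X Gk by (intro exI[of _ X]) blast
qed

text \<open>As long as the current set is not a transversal, \<open>hitting_set\<close> offers
  \<open>m\<close> elements one of which \<open>K\<close> must contain. The last hypothesis
  guarantees \<open>b\<close> such rounds, leading to at most \<open>m ^ b\<close> sets of size
  \<open>card U + b\<close>.\<close>

lemma card_above_le_branch:
  assumes "\<G> \<subseteq> nsets V k" "\<And>K. K \<in> \<F> \<Longrightarrow> K \<in> nsets V k \<and> transv \<G> K" "U \<subseteq> V"
    and "\<And>U'. U \<subseteq> U' \<Longrightarrow> U' \<subseteq> V \<Longrightarrow> card U' < card U + b \<Longrightarrow> \<not> transv \<G> U'"
  shows "card {K \<in> \<F>. U \<subseteq> K} \<le> m ^ b * N (card U + b)"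
  using assms(3,4)
proof (induction b arbitrary: U)
  case 0
  have "card {K \<in> \<F>. U \<subseteq> K} \<le> card {K \<in> nsets V k. U \<subseteq> K}"
    using assms(2) by (intro card_mono) (auto simp: finite_imp_finite_nsets)
  then show ?case using card_above[OF 0(1)] by simp
next
  case (Suc b)
  have fF: "finite \<F>"
    using assms(2) finite_subset[of \<F> "nsets V k"] by (auto simp: finite_imp_finite_nsets)
  have fU: "finite U" using Suc.prems(1) by (rule finite_subset_V)
  have "\<not> transv \<G> U" using Suc.prems(2)[of U] Suc.prems(1) by simp
  then obtain X where X: "X \<subseteq> V" "card X = m" "X \<inter> U = {}"
    "\<And>K. transv \<G> K \<Longrightarrow> U \<subseteq> K \<Longrightarrow> K \<inter> X \<noteq> {}"
    using hitting_set[OF assms(1) Suc.prems(1)] by metis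
  have fX: "finite X" using X(1) by (rule finite_subset_V)
  have "{K \<in> \<F>. U \<subseteq> K} \<subseteq> (\<Union>x\<in>X. {K \<in> \<F>. insert x U \<subseteq> K})"
  proof
    fix K assume K: "K \<in> {K \<in> \<F>. U \<subseteq> K}"
    then have "K \<inter> X \<noteq> {}" using X(4)[of K] assms(2)[of K] by simp
    then show "K \<in> (\<Union>x\<in>X. {K \<in> \<F>. insert x U \<subseteq> K})" using K by auto
  qed
  then have "card {K \<in> \<F>. U \<subseteq> K} \<le> card (\<Union>x\<in>X. {K \<in> \<F>. insert x U \<subseteq> K})"
    using fF fX by (intro card_mono) auto
  also have "\<dots> \<le> (\<Sum>x\<in>X. card {K \<in> \<F>. insert x U \<subseteq> K})" by (rule card_UN_le[OF fX])
  also have "\<dots> \<le> (\<Sum>x\<in>X. m ^ b * N (card U + Suc b))"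
  proof (rule sum_mono)
    fix x assume x: "x \<in> X"
    then have "x \<notin> U" using X(3) by blast
    then have c: "card (insert x U) = Suc (card U)" using fU by simp
    have "card {K \<in> \<F>. insert x U \<subseteq> K} \<le> m ^ b * N (card (insert x U) + b)"
    proof (rule Suc.IH)
      show "insert x U \<subseteq> V" using x X(1) Suc.prems(1) by auto
      fix U' assume "insert x U \<subseteq> U'" "U' \<subseteq> V" "card U' < card (insert x U) + b"
      then show "\<not> transv \<G> U'" using Suc.prems(2)[of U'] c by auto
    qed
    then show "card {K \<in> \<F>. insert x U \<subseteq> K} \<le> m ^ b * N (card U + Suc b)" using c by simp
  qed
  finally show ?case using X(2) by (simp add: ac_simps)
qed

end

text \<open>A saturated pair: each family is determined by the other. Non-triviality is phrased
  through transversals, since a \<open>t\<close>-set that is a transversal is contained in every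
  member of the family.\<close>

locale cross_pair = cross_params +
  fixes \<F> \<G> :: "nat set set"
  assumes F_eq: "\<F> = {K \<in> nsets V k. transv \<G> K}"
    and G_eq: "\<G> = {K \<in> nsets V k. transv \<F> K}"
    and nontriv: "\<And>U. card U = t \<Longrightarrow> \<not> transv \<F> U \<and> \<not> transv \<G> U"
begin

text \<open>Used for the interpretation \<open>sw\<close>, through which each fact about
  \<open>\<F>\<close> also serves for \<open>\<G>\<close>.\<close>

lemma swapped: "cross_pair n k t \<G> \<F>"
  using F_eq G_eq nontriv by unfold_locales blast+

lemma F_sub: "\<F> \<subseteq> nsets V k" and G_sub: "\<G> \<subseteq> nsets V k"
  using F_eq G_eq by blast+

lemma finite_F [simp]: "finite \<F>"
  using finite_subset[OF F_sub] by (simp add: finite_imp_finite_nsets)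

lemma F_trans: "K \<in> \<F> \<Longrightarrow> K \<in> nsets V k \<and> transv \<G> K"
  using F_eq by blast

lemma F_inter: "F \<in> \<F> \<Longrightarrow> G \<in> \<G> \<Longrightarrow> t \<le> card (F \<inter> G)"
  using F_trans unfolding transv_def by blast

lemmas F_branch = card_above_le_branch[where \<F> = \<F>, OF G_sub F_trans]

text \<open>Sets \<open>W\<close> in \<open>base \<G>\<close> are charged with all
  \<open>N (t+1)\<close> sets above them. Any other \<open>W\<close> in the cover is not a
  transversal of \<open>\<G>\<close>, so one branching step reduces its share to
  \<open>m * N (t+2)\<close>.\<close>

lemma F_cover:
  assumes "finite \<W>" "\<And>W. W \<in> \<W> \<Longrightarrow> W \<subseteq> V \<and> card W = t + 1"
    and "\<And>K. K \<in> \<F> \<Longrightarrow> \<exists>W\<in>\<W>. W \<subseteq> K"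
  shows "card \<F> \<le> card (base \<G>) * N (t+1) + card \<W> * m * N (t+2)"
proof -
  let ?A = "\<Union>W\<in>base \<G>. {K \<in> \<F>. W \<subseteq> K}" and ?B = "\<Union>W\<in>\<W> - base \<G>. {K \<in> \<F>. W \<subseteq> K}"
  have A: "card ?A \<le> card (base \<G>) * N (t+1)"
  proof -
    have "card ?A \<le> (\<Sum>W\<in>base \<G>. card {K \<in> \<F>. W \<subseteq> K})" by (intro card_UN_le) simp
    also have "\<dots> \<le> (\<Sum>W\<in>base \<G>. N (t+1))"
    proof (rule sum_mono)
      fix W assume "W \<in> base \<G>"
      then have "W \<subseteq> V" "card W = t + 1" using baseD by auto
      moreover have "card {K \<in> \<F>. W \<subseteq> K} \<le> card {K \<in> nsets V k. W \<subseteq> K}"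
        using F_sub by (intro card_mono) (auto simp: finite_imp_finite_nsets)
      ultimately show "card {K \<in> \<F>. W \<subseteq> K} \<le> N (t+1)" using card_above[of W] by simp
    qed
    finally show ?thesis by simp
  qed
  have B: "card ?B \<le> card \<W> * (m * N (t+2))"
  proof -
    have "card ?B \<le> (\<Sum>W\<in>\<W> - base \<G>. card {K \<in> \<F>. W \<subseteq> K})" using assms(1) by (intro card_UN_le) simp
    also have "\<dots> \<le> (\<Sum>W\<in>\<W> - base \<G>. m * N (t+2))"
    proof (rule sum_mono)
      fix W assume W: "W \<in> \<W> - base \<G>"
      then have *: "W \<subseteq> V" "card W = t + 1" "\<not> transv \<G> W" using assms(2) unfolding base_def by auto
      have "card {K \<in> \<F>. W \<subseteq> K} \<le> m ^ 1 * N (card W + 1)"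
      proof (rule F_branch)
        fix U' assume "W \<subseteq> U'" "U' \<subseteq> V" "card U' < card W + 1"
        then have "U' = W" using finite_subset[OF _ finite_V] by (metis Suc_eq_plus1 card_seteq less_Suc_eq_le)
        then show "\<not> transv \<G> U'" using * by simp
      qed (use * in auto)
      then show "card {K \<in> \<F>. W \<subseteq> K} \<le> m * N (t+2)" using * by simp
    qed
    also have "\<dots> \<le> card \<W> * (m * N (t+2))"
      using assms(1) by (simp add: card_mono mult_le_mono1)
    finally show ?thesis .
  qed
  have "\<F> \<subseteq> ?A \<union> ?B"
  proof
    fix K assume K: "K \<in> \<F>"
    from assms(3)[OF K] obtain W where "W \<in> \<W>" "W \<subseteq> K" by auto
    then show "K \<in> ?A \<union> ?B" using K by (cases "W \<in> base \<G>") auto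
  qed
  moreover have "finite (?A \<union> ?B)" using assms(1) by auto
  ultimately have "card \<F> \<le> card (?A \<union> ?B)" by (intro card_mono)
  also have "\<dots> \<le> card ?A + card ?B" by (rule card_Un_le)
  finally show ?thesis using A B by (simp add: ac_simps)
qed

text \<open>Every member of \<open>\<F>\<close> contains a \<open>t\<close>-subset \<open>D\<close>
  of the transversal \<open>S\<close>, and \<open>D\<close> itself is not a transversal of
  \<open>\<G>\<close>. One branching step above each \<open>D\<close> produces the cover of
  \<open>(t + 1)\<close>-sets needed for \<open>F_cover\<close>.\<close>

lemma F_cover_t:
  assumes "transv \<F> S" "card S = t + a"
  shows "card \<F> \<le> card (base \<G>) * N (t+1) + ((t + a) choose t) * m * m * N (t+2)"
proof -
  let ?D = "{D. D \<subseteq> S \<and> card D = t}"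
  have S: "S \<subseteq> V" "finite S" using assms(1) finite_subset[OF _ finite_V] unfolding transv_def by auto
  have fD: "finite ?D" using S by simp
  have "\<exists>X. X \<subseteq> V \<and> card X = m \<and> X \<inter> D = {} \<and> (\<forall>K. transv \<G> K \<longrightarrow> D \<subseteq> K \<longrightarrow> K \<inter> X \<noteq> {})" if "D \<in> ?D" for D
    using hitting_set[OF G_sub, of D] nontriv[of D] that S by auto
  then obtain X where X: "\<And>D. D \<in> ?D \<Longrightarrow> X D \<subseteq> V \<and> card (X D) = m \<and> X D \<inter> D = {} \<and>
      (\<forall>K. transv \<G> K \<longrightarrow> D \<subseteq> K \<longrightarrow> K \<inter> X D \<noteq> {})" by metis
  have fX: "finite (X D)" if "D \<in> ?D" for D using X[OF that] finite_subset_V by blast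
  define \<W> where "\<W> = (\<Union>D\<in>?D. (\<lambda>x. insert x D) ` X D)"
  have fW: "finite \<W>" unfolding \<W>_def using fD fX by blast
  have "card \<W> \<le> (\<Sum>D\<in>?D. card ((\<lambda>x. insert x D) ` X D))" unfolding \<W>_def by (rule card_UN_le[OF fD])
  also have "\<dots> \<le> (\<Sum>D\<in>?D. m)"
    using X fX by (intro sum_mono) (metis card_image_le)
  also have "\<dots> = ((t + a) choose t) * m" using n_subsets[OF S(2), of t] assms(2) by simp
  finally have cW: "card \<W> \<le> ((t + a) choose t) * m" .
  have "card \<F> \<le> card (base \<G>) * N (t+1) + card \<W> * m * N (t+2)"
  proof (rule F_cover[OF fW])
    fix W assume "W \<in> \<W>"
    then obtain D x where D: "D \<in> ?D" "x \<in> X D" "W = insert x D" unfolding \<W>_def by auto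
    then have "x \<notin> D" "x \<in> V" using X[of D] by auto
    moreover have "finite D" using D S by (auto intro: finite_subset)
    ultimately show "W \<subseteq> V \<and> card W = t + 1" using D S by auto
  next
    fix K assume K: "K \<in> \<F>"
    have "t \<le> card (S \<inter> K)" using assms(1) K unfolding transv_def by auto
    then obtain D where D: "D \<subseteq> S \<inter> K" "card D = t" by (meson obtain_subset_with_card_n)
    then have "K \<inter> X D \<noteq> {}" using X[of D] F_trans[OF K] by auto
    then obtain x where "x \<in> K" "x \<in> X D" by auto
    then show "\<exists>W\<in>\<W>. W \<subseteq> K" using D unfolding \<W>_def
      by (intro bexI[of _ "insert x D"]) auto
  qed
  also have "card \<W> * m * N (t+2) \<le> ((t + a) choose t) * m * m * N (t+2)"
    using cW by (intro mult_le_mono1)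
  finally show ?thesis by simp
qed

text \<open>As before a member of \<open>\<F>\<close> contains a \<open>t\<close>-subset of
  \<open>S\<close>; now all \<open>b\<close> available branching steps are used. This bound yields
  \<open>\<phi>\<close>.\<close>

lemma F_cover_b:
  assumes "transv \<F> S" "card S = t + a" "\<And>U. transv \<G> U \<Longrightarrow> t + b \<le> card U"
  shows "card \<F> \<le> ((t + a) choose t) * (m ^ b * N (t + b))"
proof -
  let ?D = "{D. D \<subseteq> S \<and> card D = t}"
  have S: "S \<subseteq> V" "finite S" using assms(1) finite_subset[OF _ finite_V] unfolding transv_def by auto
  have fD: "finite ?D" using S by simp
  have "\<F> \<subseteq> (\<Union>D\<in>?D. {K \<in> \<F>. D \<subseteq> K})"
  proof
    fix K assume K: "K \<in> \<F>"
    have "t \<le> card (S \<inter> K)" using assms(1) K unfolding transv_def by auto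
    then obtain D where "D \<subseteq> S \<inter> K" "card D = t" by (meson obtain_subset_with_card_n)
    then show "K \<in> (\<Union>D\<in>?D. {K \<in> \<F>. D \<subseteq> K})" using K by auto
  qed
  then have "card \<F> \<le> card (\<Union>D\<in>?D. {K \<in> \<F>. D \<subseteq> K})" using fD by (intro card_mono) auto
  also have "\<dots> \<le> (\<Sum>D\<in>?D. card {K \<in> \<F>. D \<subseteq> K})" by (rule card_UN_le[OF fD])
  also have "\<dots> \<le> (\<Sum>D\<in>?D. m ^ b * N (t + b))"
  proof (rule sum_mono)
    fix D assume "D \<in> ?D"
    then show "card {K \<in> \<F>. D \<subseteq> K} \<le> m ^ b * N (t + b)"
      using F_branch[of D b] assms(3) S by fastforce
  qed
  also have "\<dots> = ((t + a) choose t) * (m ^ b * N (t + b))" using n_subsets[OF S(2), of t] assms(2) by simp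
  finally show ?thesis .
qed

text \<open>With two transversals the cover has \<open>m + 2 * t\<close> sets instead of about
  \<open>(t + 1) * m\<close>. Fix \<open>x \<in> S\<^sub>1 - S\<^sub>2\<close> and
  \<open>D = S\<^sub>1 - {x}\<close>. Only sets above \<open>D\<close> require branching; a set
  \<open>K\<close> missing some \<open>d \<in> D\<close> contains the rest of
  \<open>S\<^sub>1\<close>, and \<open>S\<^sub>2\<close> forces one of at most two further
  elements.\<close>

lemma two_base_cover:
  assumes S: "S\<^sub>1 \<in> base \<F>" "S\<^sub>2 \<in> base \<F>" "S\<^sub>1 \<noteq> S\<^sub>2"
  shows "\<exists>\<W>. finite \<W> \<and> card \<W> \<le> m + 2 * t \<and> (card (S\<^sub>1 \<inter> S\<^sub>2) = t \<longrightarrow> card \<W> \<le> m + t) \<and>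
    (\<forall>W\<in>\<W>. W \<subseteq> V \<and> card W = t + 1) \<and>
    (\<forall>K. transv \<G> K \<longrightarrow> t \<le> card (K \<inter> S\<^sub>1) \<longrightarrow> t \<le> card (K \<inter> S\<^sub>2) \<longrightarrow> (\<exists>W\<in>\<W>. W \<subseteq> K))"
proof -
  have S1: "S\<^sub>1 \<subseteq> V" "finite S\<^sub>1" "card S\<^sub>1 = t + 1" and S2: "S\<^sub>2 \<subseteq> V" "finite S\<^sub>2" "card S\<^sub>2 = t + 1"
    using baseD S by auto
  have diff: "card (S\<^sub>1 - S\<^sub>2) = t + 1 - card (S\<^sub>1 \<inter> S\<^sub>2)" "card (S\<^sub>2 - S\<^sub>1) = t + 1 - card (S\<^sub>1 \<inter> S\<^sub>2)"
    using S1 S2 by (simp_all add: card_Diff_subset_Int Int_commute)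
  obtain x where x: "x \<in> S\<^sub>1" "x \<notin> S\<^sub>2" using S1 S2 S(3)
    by (metis card_subset_eq subsetI)
  obtain y where y: "y \<in> S\<^sub>2" "y \<notin> S\<^sub>1" using S1 S2 S(3)
    by (metis card_subset_eq subsetI)
  \<comment> \<open>If \<open>S\<^sub>2 - S\<^sub>1\<close> has a second element, \<open>y'\<close>
    is one; otherwise \<open>y'\<close> falls back to \<open>y\<close>, which gives the smaller
    cover of size \<open>m + t\<close>.\<close>
  have "\<exists>y'. y' \<in> S\<^sub>2 - S\<^sub>1 \<and> (if card (S\<^sub>1 \<inter> S\<^sub>2) = t then y' = y else y' \<noteq> y)"
  proof (cases "card (S\<^sub>1 \<inter> S\<^sub>2) = t")
    case False
    have "card (S\<^sub>1 \<inter> S\<^sub>2) \<le> card (S\<^sub>1 - {x})" using x S1 by (intro card_mono) auto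
    then have "card (S\<^sub>1 \<inter> S\<^sub>2) < t" using False x S1 by simp
    then have "1 < card (S\<^sub>2 - S\<^sub>1)" using diff by simp
    then have "card (S\<^sub>2 - S\<^sub>1 - {y}) \<noteq> 0" using y S2 by simp
    then have "S\<^sub>2 - S\<^sub>1 - {y} \<noteq> {}" by (metis card.empty)
    then show ?thesis using False by auto
  qed (use y in auto)
  then obtain y' where y': "y' \<in> S\<^sub>2" "y' \<notin> S\<^sub>1" "card (S\<^sub>1 \<inter> S\<^sub>2) = t \<Longrightarrow> y' = y" "card (S\<^sub>1 \<inter> S\<^sub>2) \<noteq> t \<Longrightarrow> y' \<noteq> y"
    by (metis DiffE)
  define D where "D = S\<^sub>1 - {x}"
  have D: "D \<subseteq> V" "finite D" "card D = t" "x \<notin> D" "D \<subseteq> S\<^sub>1" using S1 x unfolding D_def by auto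
  obtain X where X: "X \<subseteq> V" "card X = m" "X \<inter> D = {}"
    "\<And>K. transv \<G> K \<Longrightarrow> D \<subseteq> K \<Longrightarrow> K \<inter> X \<noteq> {}"
    using hitting_set[OF G_sub D(1)] nontriv[OF D(3)] by metis
  have fX: "finite X" using X(1) by (rule finite_subset_V)
  let ?A = "(\<lambda>z. insert z D) ` X" and ?B = "\<lambda>y. (\<lambda>d. insert y (S\<^sub>1 - {d})) ` D"
  define \<W> where "\<W> = ?A \<union> (?B y \<union> ?B y')"
  have cA: "card ?A \<le> m" using card_image_le[OF fX] X(2) by auto
  have cB: "card (?B z) \<le> t" for z using card_image_le[OF D(2)] D(3) by auto
  have "card \<W> \<le> card ?A + card (?B y \<union> ?B y')" unfolding \<W>_def by (rule card_Un_le)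
  also have "\<dots> \<le> card ?A + (card (?B y) + card (?B y'))" using card_Un_le by (rule add_left_mono)
  finally have c1: "card \<W> \<le> m + 2 * t" using cA cB[of y] cB[of y'] by linarith
  have c2: "card \<W> \<le> m + t" if "card (S\<^sub>1 \<inter> S\<^sub>2) = t"
  proof -
    have "y' = y" using y'(3)[OF that] .
    then have "card \<W> \<le> card ?A + card (?B y)" unfolding \<W>_def using card_Un_le[of ?A "?B y"] by simp
    then show ?thesis using cA cB[of y] by linarith
  qed
  have W: "W \<subseteq> V \<and> card W = t + 1" if W_in: "W \<in> \<W>" for W
  proof -
    consider z where "z \<in> X" "W = insert z D" | d z where "d \<in> D" "z \<in> {y, y'}" "W = insert z (S\<^sub>1 - {d})"
      using W_in unfolding \<W>_def by blast
    then show ?thesis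
    proof cases
      case 1
      then have "z \<notin> D" using X(3) by auto
      then show ?thesis using 1 X(1) D by auto
    next
      case 2
      then have "z \<notin> S\<^sub>1" "z \<in> V" "d \<in> S\<^sub>1" using y y' S2 D by auto
      then show ?thesis using 2 S1 by auto
    qed
  qed
  text \<open>Let \<open>K\<close> miss \<open>d \<in> S\<^sub>1\<close>, \<open>d \<noteq> x\<close>. If \<open>d \<in> S\<^sub>2\<close>, then \<open>K\<close> contains \<open>S\<^sub>2 - {d}\<close>, hence \<open>y\<close>;
    otherwise \<open>S\<^sub>2 - S\<^sub>1\<close> has at least two elements, and \<open>K\<close> misses at most one of them.\<close>
  have cov: "\<exists>W\<in>\<W>. W \<subseteq> K" if K: "transv \<G> K" "t \<le> card (K \<inter> S\<^sub>1)" "t \<le> card (K \<inter> S\<^sub>2)" for K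
  proof (cases "D \<subseteq> K")
    case True
    then obtain z where "z \<in> K" "z \<in> X" using X(4) K by blast
    then show ?thesis using True unfolding \<W>_def by (intro bexI[of _ "insert z D"]) auto
  next
    case False
    have miss: "e = e'" if "e \<in> S" "e' \<in> S" "e \<notin> K" "e' \<notin> K" "finite S" "card S = t + 1" "t \<le> card (K \<inter> S)" for e e' S
    proof (rule ccontr)
      assume "e \<noteq> e'"
      have "card (K \<inter> S) \<le> card (S - {e, e'})" using that by (intro card_mono) auto
      also have "\<dots> = t + 1 - 2" using that \<open>e \<noteq> e'\<close> by (subst card_Diff_subset) auto
      finally show False using that t_pos by linarith
    qed
    obtain d where d: "d \<in> D" "d \<notin> K" using False by auto
    have sub: "S\<^sub>1 - {d} \<subseteq> K" using miss[of d S\<^sub>1] d D S1 K(2) by blast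
    have "y \<in> K \<or> y' \<in> K"
    proof (rule ccontr)
      assume n: "\<not> (y \<in> K \<or> y' \<in> K)"
      then have "y = y'" using miss[of y S\<^sub>2 y'] y y' S2 K(3) by auto
      then have "card (S\<^sub>1 \<inter> S\<^sub>2) = t" using y' by auto
      then have "card (S\<^sub>1 - S\<^sub>2) = 1" using diff by simp
      then have "d \<in> S\<^sub>2" using x d D by (metis DiffI card_1_singletonE singletonD subsetD)
      then show False using miss[of y S\<^sub>2 d] y d n D S2 K(3) by auto
    qed
    then show ?thesis
    proof
      assume "y \<in> K"
      then show ?thesis using sub d unfolding \<W>_def by (intro bexI[of _ "insert y (S\<^sub>1 - {d})"]) auto
    next
      assume "y' \<in> K"
      then show ?thesis using sub d unfolding \<W>_def by (intro bexI[of _ "insert y' (S\<^sub>1 - {d})"]) auto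
    qed
  qed
  have "finite \<W>" unfolding \<W>_def using fX D(2) by simp
  then show ?thesis using c1 c2 W cov by blast
qed

lemma F_cover_two:
  assumes "2 \<le> card (base \<F>)"
  shows "card \<F> \<le> card (base \<G>) * N (t+1) + (m + 2 * t) * m * N (t+2)"
proof -
  obtain S\<^sub>1 S\<^sub>2 where S: "S\<^sub>1 \<in> base \<F>" "S\<^sub>2 \<in> base \<F>" "S\<^sub>1 \<noteq> S\<^sub>2"
    using assms card_le_Suc0_iff_eq[OF finite_base, of \<F>] by auto
  obtain \<W> where W: "finite \<W>" "card \<W> \<le> m + 2 * t" "\<And>W. W \<in> \<W> \<Longrightarrow> W \<subseteq> V \<and> card W = t + 1"
    "\<And>K. transv \<G> K \<Longrightarrow> t \<le> card (K \<inter> S\<^sub>1) \<Longrightarrow> t \<le> card (K \<inter> S\<^sub>2) \<Longrightarrow> \<exists>W\<in>\<W>. W \<subseteq> K"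
    using two_base_cover[OF S] by blast
  have "card \<F> \<le> card (base \<G>) * N (t+1) + card \<W> * m * N (t+2)"
  proof (rule F_cover[OF W(1,3)])
    fix K assume K: "K \<in> \<F>"
    have "t \<le> card (K \<inter> S)" if "S \<in> base \<F>" for S
      using that K unfolding base_def transv_def by (auto simp: Int_commute)
    then show "\<exists>W\<in>\<W>. W \<subseteq> K" using W(4) F_trans[OF K] S by blast
  qed
  also have "card \<W> * m * N (t+2) \<le> (m + 2 * t) * m * N (t+2)" using W(2) by (intro mult_le_mono1)
  finally show ?thesis by simp
qed

text \<open>Pad \<open>T\<close> to a \<open>k\<close>-set with elements outside
  \<open>T \<union> S\<close>, for which \<open>n\<close> leaves room. By saturation the padded set
  belongs to \<open>\<F>\<close>, so \<open>S\<close> meets it in at least \<open>t\<close>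
  elements, and all of these lie in \<open>T\<close>.\<close>

lemma base_cross:
  assumes T: "T \<in> base \<G>" and S: "S \<in> base \<F>"
  shows "t \<le> card (T \<inter> S)"
proof -
  have T': "T \<subseteq> V" "finite T" "card T = t + 1" and S': "S \<subseteq> V" "finite S" "card S = t + 1"
    using baseD T S by auto
  have "card (V - (T \<union> S)) = n - card (T \<union> S)" using T' S' by (subst card_Diff_subset) auto
  moreover have "card (T \<union> S) \<le> 2 * t + 2" using card_Un_le[of T S] T' S' by linarith
  ultimately have "k - (t + 1) \<le> card (V - (T \<union> S))" using n_gt t_less by linarith
  then obtain R where R: "R \<subseteq> V - (T \<union> S)" "card R = k - (t + 1)" by (meson obtain_subset_with_card_n)
  have fR: "finite R" using R(1) finite_subset[of R V] by auto
  have "card (T \<union> R) = k" using R T' fR t_less by (subst card_Un_disjoint) auto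
  then have "T \<union> R \<in> nsets V k" using R T' fR by (auto simp: nsets_def)
  moreover have "transv \<G> (T \<union> R)" 
    using transv_mono[of \<G> T "T \<union> R"] baseD[OF T] R(1) by blast
  ultimately have "T \<union> R \<in> \<F>" using F_eq by blast
  then have "t \<le> card (S \<inter> (T \<union> R))" using S unfolding base_def transv_def by auto
  moreover have "S \<inter> (T \<union> R) = T \<inter> S" using R by auto
  ultimately show ?thesis by simp
qed

end

section \<open>Minimal transversals\<close>

text \<open>The two traces on \<open>S\<close> have at least \<open>t\<close> elements each, but
  their union has at most \<open>t + 1\<close>, so they share \<open>t - 1\<close> elements. These
  can only be \<open>E\<close>; what remains is one element from each pair. The four outcomes form a
  4-cycle under meeting in \<open>t\<close> elements.\<close>

lemma grid_element:
  fixes t :: nat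
  assumes "finite E" "card E + 1 = t" "distinct [a, b, c, d]" "{a, b, c, d} \<inter> E = {}"
    and "finite S" "card S = t + 1" "t \<le> card (S \<inter> (E \<union> {a, b}))" "t \<le> card (S \<inter> (E \<union> {c, d}))"
  shows "S \<in> {E \<union> {a, c}, E \<union> {a, d}, E \<union> {b, c}, E \<union> {b, d}}"
proof -
  let ?A = "S \<inter> (E \<union> {a, b})" and ?B = "S \<inter> (E \<union> {c, d})"
  have "card ?A + card ?B = card (?A \<union> ?B) + card (?A \<inter> ?B)"
    using assms by (intro card_Un_Int) auto
  moreover have "card (?A \<union> ?B) \<le> card S" using assms by (intro card_mono) auto
  moreover have AB: "?A \<inter> ?B \<subseteq> E" using assms(3) by auto
  ultimately have "card E \<le> card (?A \<inter> ?B)" using assms by linarith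
  then have "?A \<inter> ?B = E" using AB assms(1) by (intro card_seteq) auto
  then have ES: "E \<subseteq> S" by auto
  have "S \<inter> {a, b} \<noteq> {}"
  proof
    assume "S \<inter> {a, b} = {}"
    then have "card ?A \<le> card E" using assms(1) by (intro card_mono) auto
    then show False using assms by linarith
  qed
  moreover have "S \<inter> {c, d} \<noteq> {}"
  proof
    assume "S \<inter> {c, d} = {}"
    then have "card ?B \<le> card E" using assms(1) by (intro card_mono) auto
    then show False using assms by linarith
  qed
  moreover have "S = E \<union> {x, y}" if "x \<in> S \<inter> {a, b}" "y \<in> S \<inter> {c, d}" for x y
  proof -
    have "x \<noteq> y" "{x, y} \<inter> E = {}" using that assms(3,4) by auto
    then have "card (E \<union> {x, y}) = card E + 2" using assms(1) by (subst card_Un_disjoint) auto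
    then have "card S \<le> card (E \<union> {x, y})" using assms by linarith
    then show ?thesis using card_seteq[of S "E \<union> {x, y}"] ES that assms(5) by auto
  qed
  ultimately show ?thesis by blast
qed

lemma obtain_grid:
  fixes t :: nat
  assumes "finite A" "finite B" "card A = t + 1" "card B = t + 1" "card (A \<inter> B) + 1 = t"
  obtains E a b c d where "finite E" "card E + 1 = t" "distinct [a, b, c, d]" "{a, b, c, d} \<inter> E = {}"
    "A = E \<union> {a, b}" "B = E \<union> {c, d}"
proof -
  have "card (A - B) = 2" "card (B - A) = 2"
    using assms by (auto simp: card_Diff_subset_Int Int_commute)
  then obtain a b c d where *: "A - B = {a, b}" "a \<noteq> b" "B - A = {c, d}" "c \<noteq> d"
    by (auto simp: card_2_iff)
  show thesis
  proof (rule that[of "A \<inter> B" a b c d])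
    show "A = A \<inter> B \<union> {a, b}" "B = A \<inter> B \<union> {c, d}" using * by blast+
    have "a \<in> A - B" "b \<in> A - B" "c \<in> B - A" "d \<in> B - A" using * by auto
    then show "distinct [a, b, c, d]" "{a, b, c, d} \<inter> (A \<inter> B) = {}" using * by auto
  qed (use assms in auto)
qed

lemma card_Int_ge_of_common_neighbour:
  fixes t :: nat
  assumes "finite S" "card S = t + 1" "finite A" "t \<le> card (S \<inter> A)" "t \<le> card (S \<inter> B)"
  shows "t \<le> card (A \<inter> B) + 1"
proof -
  have "card (S \<inter> A) + card (S \<inter> B) = card ((S \<inter> A) \<union> (S \<inter> B)) + card ((S \<inter> A) \<inter> (S \<inter> B))"
    using assms by (intro card_Un_Int) auto
  moreover have "card ((S \<inter> A) \<union> (S \<inter> B)) \<le> card S" using assms by (intro card_mono) auto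
  moreover have "card ((S \<inter> A) \<inter> (S \<inter> B)) \<le> card (A \<inter> B)" using assms by (intro card_mono) auto
  ultimately show ?thesis using assms by linarith
qed

text \<open>If \<open>K\<close> met \<open>W\<close> in at most \<open>t\<close> elements, each
  trace \<open>K \<inter> T\<^sub>i\<close> would be all of \<open>K \<inter> W\<close>. Then
  \<open>K \<inter> W\<close> would be a \<open>t\<close>-set inside the common
  intersection.\<close>

lemma card_Int_ge_of_three:
  fixes t :: nat
  assumes "finite W" "T\<^sub>1 \<subseteq> W" "T\<^sub>2 \<subseteq> W" "T\<^sub>3 \<subseteq> W" "card (T\<^sub>1 \<inter> T\<^sub>2 \<inter> T\<^sub>3) < t"
    and "t \<le> card (K \<inter> T\<^sub>1)" "t \<le> card (K \<inter> T\<^sub>2)" "t \<le> card (K \<inter> T\<^sub>3)"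
  shows "t + 1 \<le> card (K \<inter> W)"
proof (rule ccontr)
  assume "\<not> t + 1 \<le> card (K \<inter> W)"
  then have le: "card (K \<inter> W) \<le> t" by simp
  have "K \<inter> T = K \<inter> W" if "T \<subseteq> W" "t \<le> card (K \<inter> T)" for T
    using that le assms(1) by (intro card_seteq) auto
  then have "K \<inter> W \<subseteq> T\<^sub>1 \<inter> T\<^sub>2 \<inter> T\<^sub>3" and eq: "K \<inter> T\<^sub>1 = K \<inter> W" using assms by blast+
  then have "card (K \<inter> W) \<le> card (T\<^sub>1 \<inter> T\<^sub>2 \<inter> T\<^sub>3)"
    using assms finite_subset[of T\<^sub>1 W] by (intro card_mono) auto
  then show False using eq assms by simp
qed

lemma obtain_three:
  assumes "finite A" "3 \<le> card A"
  obtains x y z where "x \<in> A" "y \<in> A" "z \<in> A" "x \<noteq> y" "x \<noteq> z" "y \<noteq> z"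
proof -
  obtain B where "B \<subseteq> A" "card B = 3" using assms(2) by (meson obtain_subset_with_card_n)
  then show thesis using that by (auto simp: card_3_iff)
qed

section \<open>Structure of the \<open>(t + 1)\<close>-element transversals\<close>

context cross_pair
begin

lemma base_inter_F: "S \<in> base \<F> \<Longrightarrow> K \<in> \<F> \<Longrightarrow> t \<le> card (K \<inter> S)"
  unfolding base_def transv_def by (auto simp: Int_commute)

text \<open>A member of \<open>base \<G>\<close> above \<open>D\<close> also meets the
  \<open>m\<close>-element hitting set of \<open>D\<close>, and one such element already completes
  it to size \<open>t + 1\<close>.\<close>

lemma card_base_above:
  assumes "D \<subseteq> V" "card D = t"
  shows "card {T \<in> base \<G>. D \<subseteq> T} \<le> m"
proof -
  obtain X where X: "X \<subseteq> V" "card X = m" "X \<inter> D = {}"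
    "\<And>K. transv \<G> K \<Longrightarrow> D \<subseteq> K \<Longrightarrow> K \<inter> X \<noteq> {}"
    using hitting_set[OF G_sub assms(1)] nontriv[OF assms(2)] by metis
  have fX: "finite X" using X(1) by (rule finite_subset_V)
  have fD: "finite D" using assms(1) by (rule finite_subset_V)
  have "{T \<in> base \<G>. D \<subseteq> T} \<subseteq> (\<lambda>x. insert x D) ` X"
  proof
    fix T assume "T \<in> {T \<in> base \<G>. D \<subseteq> T}"
    then have T: "T \<in> base \<G>" "D \<subseteq> T" by auto
    then obtain x where x: "x \<in> T" "x \<in> X" using X(4) baseD by blast
    then have "x \<notin> D" using X(3) by blast
    then have "card (insert x D) = t + 1" using fD assms(2) by simp
    then have "insert x D = T" using T x baseD[OF T(1)] by (intro card_seteq) auto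
    then show "T \<in> (\<lambda>x. insert x D) ` X" using x by blast
  qed
  then have "card {T \<in> base \<G>. D \<subseteq> T} \<le> card ((\<lambda>x. insert x D) ` X)" using fX by (intro card_mono) auto
  also have "\<dots> \<le> m" using card_image_le[OF fX] X(2) by auto
  finally show ?thesis .
qed

lemma card_base_le:
  assumes S: "S \<in> base \<F>"
  shows "card (base \<G>) \<le> (t + 1) * m"
proof -
  let ?D = "{D. D \<subseteq> S \<and> card D = t}"
  have S': "S \<subseteq> V" "finite S" "card S = t + 1" using baseD[OF S] by auto
  have fD: "finite ?D" using S' by simp
  have "base \<G> \<subseteq> (\<Union>D\<in>?D. {T \<in> base \<G>. D \<subseteq> T})"
  proof
    fix T assume T: "T \<in> base \<G>"
    obtain D where "D \<subseteq> T \<inter> S" "card D = t" using base_cross[OF T S] by (meson obtain_subset_with_card_n)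
    then show "T \<in> (\<Union>D\<in>?D. {T \<in> base \<G>. D \<subseteq> T})" using T by auto
  qed
  then have "card (base \<G>) \<le> card (\<Union>D\<in>?D. {T \<in> base \<G>. D \<subseteq> T})" using fD by (intro card_mono) auto
  also have "\<dots> \<le> (\<Sum>D\<in>?D. card {T \<in> base \<G>. D \<subseteq> T})" by (rule card_UN_le[OF fD])
  also have "\<dots> \<le> (\<Sum>D\<in>?D. m)" using card_base_above S'(1) by (intro sum_mono) auto
  also have "\<dots> = (t + 1) * m" using n_subsets[OF S'(2), of t] S'(3) by simp
  finally show ?thesis .
qed

text \<open>A common neighbour of \<open>T\<^sub>1\<close> and \<open>T\<^sub>2\<close> forces their
  intersection to have exactly \<open>t - 1\<close> elements, so \<open>base \<F>\<close> lies in
  the four sets of a grid. Any three of these include an opposite pair, which confines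
  \<open>base \<G>\<close> to four sets in turn, and the third one excludes one of those.\<close>

lemma base_far_pair:
  assumes T: "T\<^sub>1 \<in> base \<G>" "T\<^sub>2 \<in> base \<G>" "card (T\<^sub>1 \<inter> T\<^sub>2) < t" and ne: "base \<F> \<noteq> {}"
  shows "card (base \<F>) \<le> 4" "3 \<le> card (base \<F>) \<Longrightarrow> card (base \<G>) \<le> 3"
proof -
  have T1: "finite T\<^sub>1" "card T\<^sub>1 = t + 1" and T2: "finite T\<^sub>2" "card T\<^sub>2 = t + 1" using T baseD by auto
  have Sfin: "finite S \<and> card S = t + 1" if "S \<in> base \<F>" for S using that baseD by auto
  have Tfin: "finite S \<and> card S = t + 1" if "S \<in> base \<G>" for S using that baseD by auto
  have cr: "t \<le> card (S \<inter> T)" "t \<le> card (T \<inter> S)" if "S \<in> base \<F>" "T \<in> base \<G>" for S T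
    using base_cross[OF that(2,1)] by (simp_all add: Int_commute)
  obtain S where S: "S \<in> base \<F>" using ne by auto
  have "t \<le> card (T\<^sub>1 \<inter> T\<^sub>2) + 1"
    using card_Int_ge_of_common_neighbour[of S t T\<^sub>1 T\<^sub>2] Sfin[OF S] T1(1) cr[OF S] T by blast
  then have "card (T\<^sub>1 \<inter> T\<^sub>2) + 1 = t" using T(3) by linarith
  then obtain E a b c d where E: "finite E" "card E + 1 = t" and dist: "distinct [a, b, c, d]" "{a, b, c, d} \<inter> E = {}"
    and TE: "T\<^sub>1 = E \<union> {a, b}" "T\<^sub>2 = E \<union> {c, d}"
    using obtain_grid[OF T1(1) T2(1) T1(2) T2(2)] by metis
  let ?ac = "E \<union> {a, c}" and ?ad = "E \<union> {a, d}" and ?bc = "E \<union> {b, c}" and ?bd = "E \<union> {b, d}"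
  have sub: "base \<F> \<subseteq> {?ac, ?ad, ?bc, ?bd}"
  proof
    fix S assume S: "S \<in> base \<F>"
    then show "S \<in> {?ac, ?ad, ?bc, ?bd}"
      using grid_element[OF E dist, of S] Sfin[OF S] cr[OF S T(1)] cr[OF S T(2)] TE by blast
  qed
  have "card {?ac, ?ad, ?bc, ?bd} \<le> 4"
    by (simp add: card_insert_if)
  then show "card (base \<F>) \<le> 4" using card_mono[OF _ sub] by force
  assume s3: "3 \<le> card (base \<F>)"
  have two: "\<not> base \<F> \<subseteq> {x, y}" for x y
  proof
    assume "base \<F> \<subseteq> {x, y}"
    then have "card (base \<F>) \<le> card {x, y}" by (intro card_mono) auto
    also have "\<dots> \<le> 2" by (simp add: card_insert_if)
    finally show False using s3 by simp
  qed
  \<comment> \<open>Stated for arbitrary names of the grid elements, so that the four positions of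
    the triple follow by renaming.\<close>
  have key: "card (base \<G>) \<le> 3" if d': "distinct [a, b, c, d]" "{a, b, c, d} \<inter> E = {}"
      and m: "E \<union> {a, c} \<in> base \<F>" "E \<union> {b, d} \<in> base \<F>" "E \<union> {a, d} \<in> base \<F>" for a b c d
  proof -
    have "base \<G> \<subseteq> {E \<union> {a, b}, E \<union> {a, d}, E \<union> {c, d}}"
    proof
      fix T assume T: "T \<in> base \<G>"
      have "T \<in> {E \<union> {a, b}, E \<union> {a, d}, E \<union> {c, b}, E \<union> {c, d}}"
        using d' Tfin[OF T] cr[OF m(1) T] cr[OF m(2) T] by (intro grid_element[OF E]) auto
      moreover have "T \<noteq> E \<union> {c, b}"
      proof
        assume eq: "T = E \<union> {c, b}"
        have "t \<le> card (T \<inter> (E \<union> {a, d}))" using cr[OF m(3) T] by blast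
        also have "T \<inter> (E \<union> {a, d}) = E" using eq d' by auto
        finally show False using E by simp
      qed
      ultimately show "T \<in> {E \<union> {a, b}, E \<union> {a, d}, E \<union> {c, d}}" by blast
    qed
    then have "card (base \<G>) \<le> card {E \<union> {a, b}, E \<union> {a, d}, E \<union> {c, d}}" by (intro card_mono) auto
    also have "\<dots> \<le> 3" by (simp add: card_insert_if)
    finally show ?thesis .
  qed
  \<comment> \<open>The opposite pairs are \<open>w\<^sub>1, w\<^sub>4\<close> and
    \<open>w\<^sub>2, w\<^sub>3\<close>; each alternative lists such a pair first and a third
    element after it.\<close>
  have three: "(w\<^sub>1 \<in> B \<and> w\<^sub>4 \<in> B \<and> w\<^sub>2 \<in> B) \<or> (w\<^sub>4 \<in> B \<and> w\<^sub>1 \<in> B \<and> w\<^sub>3 \<in> B)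
    \<or> (w\<^sub>3 \<in> B \<and> w\<^sub>2 \<in> B \<and> w\<^sub>4 \<in> B) \<or> (w\<^sub>2 \<in> B \<and> w\<^sub>3 \<in> B \<and> w\<^sub>1 \<in> B)"
    if "B \<subseteq> {w\<^sub>1, w\<^sub>2, w\<^sub>3, w\<^sub>4}" "\<And>x y. \<not> B \<subseteq> {x, y}" for w\<^sub>1 w\<^sub>2 w\<^sub>3 w\<^sub>4 :: "nat set" and B
  proof -
    have "w\<^sub>1 \<in> B \<or> w\<^sub>2 \<in> B" using that(1) that(2)[of w\<^sub>3 w\<^sub>4] by blast
    moreover have "w\<^sub>1 \<in> B \<or> w\<^sub>3 \<in> B" using that(1) that(2)[of w\<^sub>2 w\<^sub>4] by blast
    moreover have "w\<^sub>1 \<in> B \<or> w\<^sub>4 \<in> B" using that(1) that(2)[of w\<^sub>2 w\<^sub>3] by blast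
    moreover have "w\<^sub>2 \<in> B \<or> w\<^sub>3 \<in> B" using that(1) that(2)[of w\<^sub>1 w\<^sub>4] by blast
    moreover have "w\<^sub>2 \<in> B \<or> w\<^sub>4 \<in> B" using that(1) that(2)[of w\<^sub>1 w\<^sub>3] by blast
    moreover have "w\<^sub>3 \<in> B \<or> w\<^sub>4 \<in> B" using that(1) that(2)[of w\<^sub>1 w\<^sub>2] by blast
    ultimately show ?thesis by argo
  qed
  note three[OF sub two]
  then show "card (base \<G>) \<le> 3"
  proof (elim disjE conjE)
    assume "?ac \<in> base \<F>" "?bd \<in> base \<F>" "?ad \<in> base \<F>"
    then show ?thesis using dist by (intro key[of a b c d]) auto
  next
    assume "?bd \<in> base \<F>" "?ac \<in> base \<F>" "?bc \<in> base \<F>"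
    then show ?thesis using dist by (intro key[of b a d c]) auto
  next
    assume "?bc \<in> base \<F>" "?ad \<in> base \<F>" "?bd \<in> base \<F>"
    then show ?thesis using dist by (intro key[of b a c d]) auto
  next
    assume "?ad \<in> base \<F>" "?bc \<in> base \<F>" "?ac \<in> base \<F>"
    then show ?thesis using dist by (intro key[of a b d c]) auto
  qed
qed

text \<open>Two members of \<open>base \<G>\<close> span a \<open>(t + 2)\<close>-set
  \<open>W\<close>, and a third one avoiding their core still lies in \<open>W\<close>. By
  \<open>card_Int_ge_of_three\<close> these three push every member of \<open>\<G>\<close> into
  \<open>W\<close> up to one element, and every set of \<open>base \<F>\<close> entirely into
  \<open>W\<close>. Three sets of \<open>base \<F>\<close> then do the same for the members of
  \<open>\<F>\<close>.\<close>

lemma nonstar_bases: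
  assumes p3: "3 \<le> card (base \<G>)" and s3: "3 \<le> card (base \<F>)"
    and close: "\<And>T T'. T \<in> base \<G> \<Longrightarrow> T' \<in> base \<G> \<Longrightarrow> t \<le> card (T \<inter> T')"
    and nocore: "\<And>D. card D = t \<Longrightarrow> \<exists>T\<in>base \<G>. \<not> D \<subseteq> T"
  shows "\<exists>W\<subseteq>V. card W = t + 2 \<and> (\<forall>K\<in>\<F> \<union> \<G>. t + 1 \<le> card (K \<inter> W))"
proof -
  interpret sw: cross_pair n k t \<G> \<F> by (rule swapped)
  have card_Int_lt: "card (A \<inter> B) \<le> t" "card (A \<inter> B) + card (A \<union> B) = 2 * t + 2"
    if "finite A" "card A = t + 1" "finite B" "card B = t + 1" "A \<noteq> B" for A B :: "nat set"
  proof -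
    have "A \<inter> B \<subset> A" using that by (metis Int_lower1 Int_lower2 card_subset_eq psubsetI)
    then show "card (A \<inter> B) \<le> t" using that psubset_card_mono[of A "A \<inter> B"] by simp
    show "card (A \<inter> B) + card (A \<union> B) = 2 * t + 2" using card_Un_Int[of A B] that by simp
  qed
  obtain T\<^sub>1 T\<^sub>2 where T: "T\<^sub>1 \<in> base \<G>" "T\<^sub>2 \<in> base \<G>" "T\<^sub>1 \<noteq> T\<^sub>2"
    using obtain_three[OF finite_base p3] by metis
  have T1: "finite T\<^sub>1" "card T\<^sub>1 = t + 1" "T\<^sub>1 \<subseteq> V" and T2: "finite T\<^sub>2" "card T\<^sub>2 = t + 1" "T\<^sub>2 \<subseteq> V"
    using T baseD by auto
  have cD: "card (T\<^sub>1 \<inter> T\<^sub>2) = t"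
    using close[OF T(1,2)] card_Int_lt(1)[OF T1(1,2) T2(1,2) T(3)] by linarith
  then obtain T\<^sub>3 where T3: "T\<^sub>3 \<in> base \<G>" "\<not> T\<^sub>1 \<inter> T\<^sub>2 \<subseteq> T\<^sub>3" using nocore by blast
  have T3': "finite T\<^sub>3" "card T\<^sub>3 = t + 1" using T3 baseD by auto
  define W where "W = T\<^sub>1 \<union> T\<^sub>2"
  have W: "finite W" "W \<subseteq> V" "card W = t + 2"
    using T1 T2 card_Int_lt(2)[OF T1(1,2) T2(1,2) T(3)] cD unfolding W_def by auto
  have "T\<^sub>1 \<inter> T\<^sub>2 \<inter> T\<^sub>3 \<subset> T\<^sub>1 \<inter> T\<^sub>2" using T3 by auto
  then have c3: "card (T\<^sub>1 \<inter> T\<^sub>2 \<inter> T\<^sub>3) < t" using cD T1 psubset_card_mono[of "T\<^sub>1 \<inter> T\<^sub>2"] by auto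
  \<comment> \<open>The traces of \<open>T\<^sub>3\<close> on \<open>T\<^sub>1\<close> and
    \<open>T\<^sub>2\<close> have at least \<open>t\<close> elements each and overlap in fewer than
    \<open>t\<close>, so together they fill all \<open>t + 1\<close> elements of
    \<open>T\<^sub>3\<close>.\<close>
  have T3W: "T\<^sub>3 \<subseteq> W"
  proof -
    have "card (T\<^sub>3 \<inter> T\<^sub>1) + card (T\<^sub>3 \<inter> T\<^sub>2) = card ((T\<^sub>3 \<inter> T\<^sub>1) \<union> (T\<^sub>3 \<inter> T\<^sub>2)) + card ((T\<^sub>3 \<inter> T\<^sub>1) \<inter> (T\<^sub>3 \<inter> T\<^sub>2))"
      using T1 T2 by (intro card_Un_Int) auto
    moreover have "(T\<^sub>3 \<inter> T\<^sub>1) \<inter> (T\<^sub>3 \<inter> T\<^sub>2) = T\<^sub>1 \<inter> T\<^sub>2 \<inter> T\<^sub>3" "(T\<^sub>3 \<inter> T\<^sub>1) \<union> (T\<^sub>3 \<inter> T\<^sub>2) = T\<^sub>3 \<inter> W"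
      unfolding W_def by auto
    ultimately have "card T\<^sub>3 \<le> card (T\<^sub>3 \<inter> W)" using close[OF T3(1) T(1)] close[OF T3(1) T(2)] c3 T3' by simp
    then have "T\<^sub>3 \<inter> W = T\<^sub>3" using T3' by (intro card_seteq) auto
    then show ?thesis by auto
  qed
  have big: "t + 1 \<le> card (K \<inter> W)" if "\<And>T. T \<in> base \<G> \<Longrightarrow> t \<le> card (K \<inter> T)" for K
    using that T T3 T3W W(1) c3 by (intro card_Int_ge_of_three[of W T\<^sub>1 T\<^sub>2 T\<^sub>3]) (auto simp: W_def)
  have GW: "t + 1 \<le> card (K \<inter> W)" if "K \<in> \<G>" for K
    using big sw.base_inter_F that by blast
  have SW: "S \<subseteq> W" if S: "S \<in> base \<F>" for S
  proof -
    have "t + 1 \<le> card (S \<inter> W)" using base_cross[OF _ S] by (intro big) (simp add: Int_commute)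
    then have "S \<inter> W = S" using baseD[OF S] by (intro card_seteq) auto
    then show ?thesis by auto
  qed
  obtain S\<^sub>1 S\<^sub>2 S\<^sub>3 where S: "S\<^sub>1 \<in> base \<F>" "S\<^sub>2 \<in> base \<F>" "S\<^sub>3 \<in> base \<F>" "S\<^sub>1 \<noteq> S\<^sub>2" "S\<^sub>1 \<noteq> S\<^sub>3" "S\<^sub>2 \<noteq> S\<^sub>3"
    using obtain_three[OF finite_base s3] by metis
  have Sf: "finite S\<^sub>1" "card S\<^sub>1 = t + 1" "finite S\<^sub>2" "card S\<^sub>2 = t + 1" "finite S\<^sub>3" "card S\<^sub>3 = t + 1"
    using S baseD by auto
  \<comment> \<open>Otherwise the three sets would pairwise meet exactly in a common
    \<open>t\<close>-set. But \<open>S\<^sub>1 \<union> S\<^sub>2\<close> is all of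
    \<open>W\<close>, so \<open>S\<^sub>3\<close> would have no element outside that core.\<close>
  have "card (S\<^sub>1 \<inter> S\<^sub>2 \<inter> S\<^sub>3) < t"
  proof (rule ccontr)
    assume "\<not> card (S\<^sub>1 \<inter> S\<^sub>2 \<inter> S\<^sub>3) < t"
    then have ge: "t \<le> card (S\<^sub>1 \<inter> S\<^sub>2 \<inter> S\<^sub>3)" by simp
    have eq: "A \<inter> B = S\<^sub>1 \<inter> S\<^sub>2 \<inter> S\<^sub>3" if "S\<^sub>1 \<inter> S\<^sub>2 \<inter> S\<^sub>3 \<subseteq> A \<inter> B" "card (A \<inter> B) \<le> t" "finite A" for A B
      using card_seteq[of "A \<inter> B" "S\<^sub>1 \<inter> S\<^sub>2 \<inter> S\<^sub>3"] that ge by auto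
    have i12: "S\<^sub>1 \<inter> S\<^sub>2 = S\<^sub>1 \<inter> S\<^sub>2 \<inter> S\<^sub>3" using card_Int_lt(1)[OF Sf(1,2,3,4) S(4)] Sf by (intro eq) auto
    have i13: "S\<^sub>1 \<inter> S\<^sub>3 = S\<^sub>1 \<inter> S\<^sub>2 \<inter> S\<^sub>3" using card_Int_lt(1)[OF Sf(1,2,5,6) S(5)] Sf by (intro eq) auto
    have i23: "S\<^sub>2 \<inter> S\<^sub>3 = S\<^sub>1 \<inter> S\<^sub>2 \<inter> S\<^sub>3" using card_Int_lt(1)[OF Sf(3,4,5,6) S(6)] Sf by (intro eq) auto
    have "card (S\<^sub>1 \<inter> S\<^sub>2) \<le> t" by (rule card_Int_lt(1)[OF Sf(1,2,3,4) S(4)])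
    then have "card (S\<^sub>1 \<union> S\<^sub>2) \<ge> t + 2" using card_Int_lt(2)[OF Sf(1,2,3,4) S(4)] by linarith
    then have "S\<^sub>1 \<union> S\<^sub>2 = W" using SW S W by (intro card_seteq) auto
    then have "S\<^sub>3 \<subseteq> S\<^sub>1 \<union> S\<^sub>2" using SW S by auto
    then have "S\<^sub>3 \<subseteq> S\<^sub>1 \<inter> S\<^sub>2" using i13 i23 by blast
    then have "card S\<^sub>3 \<le> card (S\<^sub>1 \<inter> S\<^sub>2)" using Sf by (intro card_mono) auto
    then show False using card_Int_lt(1)[OF Sf(1,2,3,4) S(4)] Sf by simp
  qed
  then have FW: "t + 1 \<le> card (K \<inter> W)" if "K \<in> \<F>" for K
    using that S SW W(1) base_inter_F by (intro card_Int_ge_of_three[of W S\<^sub>1 S\<^sub>2 S\<^sub>3]) auto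
  show ?thesis using W GW FW by blast
qed

end

section \<open>Extremal families and stars\<close>

context cross_params
begin

text \<open>The size of the star part of \<open>\<H> n k t\<close>: all \<open>k\<close>-sets above
  a \<open>t\<close>-set, minus those that avoid a given \<open>m\<close>-set disjoint from
  it.\<close>

definition hub :: nat where "hub = N t - ((n - t - m) choose (k - t))"

text \<open>Describing the star by its generators \<open>insert z D\<close> gives it the form
  counted by \<open>card_up_union\<close>, so exact and approximate counts can be combined.\<close>

lemma card_star_meeting:
  assumes "D \<subseteq> V" "card D = t" "Z \<subseteq> V" "D \<inter> Z = {}" "card Z = m"
  shows "card {K \<in> nsets V k. \<exists>W\<in>(\<lambda>z. insert z D) ` Z. W \<subseteq> K} = hub"
proof -
  have tk: "card D \<le> k" using assms(2) t_less by simp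
  have eq: "{K \<in> nsets V k. \<exists>W\<in>(\<lambda>z. insert z D) ` Z. W \<subseteq> K}
      = {K \<in> nsets V k. D \<subseteq> K} - {K \<in> nsets V k. D \<subseteq> K \<and> K \<inter> Z = {}}" by auto
  have "card ({K \<in> nsets V k. D \<subseteq> K} - {K \<in> nsets V k. D \<subseteq> K \<and> K \<inter> Z = {}})
      = card {K \<in> nsets V k. D \<subseteq> K} - card {K \<in> nsets V k. D \<subseteq> K \<and> K \<inter> Z = {}}"
    by (intro card_Diff_subset) (auto simp: finite_imp_finite_nsets)
  moreover have "card {K \<in> nsets V k. D \<subseteq> K \<and> K \<inter> Z = {}} = (n - t - m) choose (k - t)"
    using card_nsets_between[OF finite_V assms(1,3,4) tk] unfolding assms(2,5) card_V .
  ultimately show ?thesis unfolding eq card_above[OF assms(1)] hub_def assms(2) by simp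
qed

lemma hub_ge: "m * N (t+1) \<le> hub + m * (m * N (t+2))"
proof -
  have V: "{1..t} \<subseteq> V" "{t+1..k+1} \<subseteq> V" using n_gt t_less unfolding V_def by auto
  let ?W = "(\<lambda>z. insert z {1..t}) ` {t+1..k+1}"
  have c: "card ?W = m"
  proof -
    have "inj_on (\<lambda>z. insert z {1..t}) {t+1..k+1}"
    proof (rule inj_onI)
      fix x y assume "x \<in> {t+1..k+1}" "y \<in> {t+1..k+1}" "insert x {1..t} = insert y {1..t}"
      then show "x = y" by (metis atLeastAtMost_iff insertE insertI1 not_less_eq_eq Suc_eq_plus1)
    qed
    then have "card ?W = card {t+1..k+1}" by (rule card_image)
    then show ?thesis unfolding m_def using t_less by simp
  qed
  have "card ?W * N (t+1) \<le> card {K \<in> nsets V k. \<exists>W\<in>?W. W \<subseteq> K} + card ?W * (card ?W * N (Suc (t+1)))"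
  proof (rule card_up_ge)
    fix W assume "W \<in> ?W"
    then obtain z where z: "z \<in> {t+1..k+1}" "W = insert z {1..t}" by blast
    then have "z \<notin> {1..t}" by simp
    then show "W \<subseteq> V \<and> card W = t + 1" using z V by auto
  qed simp
  moreover have "card {K \<in> nsets V k. \<exists>W\<in>?W. W \<subseteq> K} = hub"
    using V t_less by (intro card_star_meeting) (auto simp: m_def)
  ultimately show ?thesis using c by simp
qed

text \<open>The \<open>t\<close> exceptional sets each omit an element of \<open>{1..t}\<close>, so
  none of them belongs to the star part.\<close>

lemma card_H: "card (\<H> n k t) = hub + t"
proof -
  have V: "{1..t} \<subseteq> V" "{t+1..k+1} \<subseteq> V" using n_gt t_less unfolding V_def by auto
  let ?A = "{H \<in> nsets V k. {1..t} \<subseteq> H \<and> H \<inter> {t+1..k+1} \<noteq> {}}"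
  let ?B = "(\<lambda>j. {1..k+1} - {j}) ` {1..t}"
  have H: "\<H> n k t = ?A \<union> ?B" 
  proof -
    have "{j. 1 \<le> j \<and> j \<le> t} = {1..t}" by auto
    moreover have "{{1..k+1} - {j} | j. 1 \<le> j \<and> j \<le> t} = (\<lambda>j. {1..k+1} - {j}) ` {j. 1 \<le> j \<and> j \<le> t}"
      by blast
    ultimately show ?thesis unfolding \<H>_def V_def by (simp only:)
  qed
  have "?A = {K \<in> nsets V k. \<exists>W\<in>(\<lambda>z. insert z {1..t}) ` {t+1..k+1}. W \<subseteq> K}" by auto
  then have "card ?A = hub"
    using card_star_meeting[of "{1..t}" "{t+1..k+1}"] V t_less by (auto simp: m_def)
  moreover have "card ?B = t"
  proof -
    have "inj_on (\<lambda>j. {1..k+1} - {j}) {1..t}"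
    proof (rule inj_onI)
      fix x y assume *: "x \<in> {1..t}" "y \<in> {1..t}" "{1..k+1} - {x} = {1..k+1} - {y}"
      have "x \<in> {1..k+1}" using * t_less by auto
      moreover have "x \<notin> {1..k+1} - {y}" using *(3) by blast
      ultimately show "x = y" by blast
    qed
    then show ?thesis by (simp add: card_image)
  qed
  moreover have "?A \<inter> ?B = {}" by blast
  ultimately show ?thesis unfolding H by (subst card_Un_disjoint) (auto simp: finite_imp_finite_nsets)
qed

lemma card_near_all_eq_A:
  assumes "W \<subseteq> V" "card W = t + 2"
  shows "card {K \<in> nsets V k. t + 1 \<le> card (K \<inter> W)} = card (\<A> n k t)"
proof -
  have gen: "card {K \<in> nsets V k. t + 1 \<le> card (K \<inter> W)} = (t + 2) * ((n - (t + 2)) choose (k - (t + 1))) + N (t + 2)"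
    if "W \<subseteq> V" "card W = t + 2" for W
    using card_nsets_near_all[OF finite_V that(1), of "t + 1" k] that card_above[OF that(1)] t_less by simp
  have "{1..t+2} \<subseteq> V" using n_gt t_less unfolding V_def by auto
  then have "card {K \<in> nsets V k. t + 1 \<le> card (K \<inter> {1..t+2})} = card {K \<in> nsets V k. t + 1 \<le> card (K \<inter> W)}"
    using gen[of "{1..t+2}"] gen[OF assms] by simp
  then show ?thesis unfolding \<A>_def V_def by simp
qed

text \<open>Bonferroni for the \<open>t + 2\<close> subsets of \<open>{1..t+2}\<close> of size
  \<open>t + 1\<close>, each of which generates part of \<open>\<A> n k t\<close>.\<close>

lemma card_A_ge: "(t + 2) * N (t+1) \<le> card (\<A> n k t) + (t + 2) * ((t + 2) * N (t+2))"
proof -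
  let ?U = "{1..t+2}" and ?W = "(\<lambda>w. {1..t+2} - {w}) ` {1..t+2}"
  have V: "?U \<subseteq> V" using n_gt t_less unfolding V_def by auto
  have c: "card ?W = t + 2"
  proof -
    have "inj_on (\<lambda>w. ?U - {w}) ?U" by (rule inj_onI) blast
    then show ?thesis by (simp add: card_image)
  qed
  have "card ?W * N (t+1) \<le> card {K \<in> nsets V k. \<exists>W\<in>?W. W \<subseteq> K} + card ?W * (card ?W * N (Suc (t+1)))"
  proof (rule card_up_ge)
    fix W assume "W \<in> ?W"
    then show "W \<subseteq> V \<and> card W = t + 1" using V by auto
  qed simp
  moreover have "card {K \<in> nsets V k. \<exists>W\<in>?W. W \<subseteq> K} \<le> card {K \<in> nsets V k. t + 1 \<le> card (K \<inter> ?U)}"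
  proof (rule card_mono)
    show "{K \<in> nsets V k. \<exists>W\<in>?W. W \<subseteq> K} \<subseteq> {K \<in> nsets V k. t + 1 \<le> card (K \<inter> ?U)}"
    proof clarify
      fix K w assume "w \<in> ?U" "?U - {w} \<subseteq> K"
      then have "card (?U - {w}) \<le> card (K \<inter> ?U)" by (intro card_mono) auto
      then show "t + 1 \<le> card (K \<inter> ?U)" using \<open>w \<in> ?U\<close> by simp
    qed
  qed (simp add: finite_imp_finite_nsets)
  moreover have "card {K \<in> nsets V k. t + 1 \<le> card (K \<inter> ?U)} = card (\<A> n k t)"
    using V by (intro card_near_all_eq_A) auto
  ultimately show ?thesis using c by simp
qed

end

section \<open>Families of \<open>(t + 1)\<close>-sets with a common \<open>t\<close>-element
  core\<close>

lemma star_family_eq: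
  assumes "finite D" "card D = t" "\<And>T. T \<in> \<B> \<Longrightarrow> finite T \<and> card T = t + 1 \<and> D \<subseteq> T"
  shows "\<B> = (\<lambda>x. insert x D) ` (\<Union>\<B> - D)" "card (\<Union>\<B> - D) = card \<B>"
proof -
  have rep: "\<exists>x. x \<notin> D \<and> T = insert x D" if "T \<in> \<B>" for T
  proof -
    have "card (T - D) = 1" using assms that by (simp add: card_Diff_subset)
    then obtain x where "T - D = {x}" by (rule card_1_singletonE)
    then show ?thesis using assms(3)[OF that] by blast
  qed
  show eq: "\<B> = (\<lambda>x. insert x D) ` (\<Union>\<B> - D)"
  proof (intro equalityI subsetI)
    fix T assume "T \<in> \<B>"
    then show "T \<in> (\<lambda>x. insert x D) ` (\<Union>\<B> - D)" using rep by blast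
  next
    fix T assume "T \<in> (\<lambda>x. insert x D) ` (\<Union>\<B> - D)"
    then obtain x T' where x: "T = insert x D" "x \<in> T'" "T' \<in> \<B>" "x \<notin> D" by blast
    then obtain x' where "T' = insert x' D" using rep by blast
    then show "T \<in> \<B>" using x by blast
  qed
  have "inj_on (\<lambda>x. insert x D) (\<Union>\<B> - D)" by (rule inj_onI) blast
  then show "card (\<Union>\<B> - D) = card \<B>" using eq card_image by metis
qed

text \<open>With fewer than \<open>t\<close> elements of \<open>D\<close> in \<open>K\<close>, the
  one petal element of each \<open>T\<close> has to make up the deficit. So the deficit is exactly
  one, and every petal element is in \<open>K\<close>.\<close>

lemma star_family_miss:
  fixes t :: nat
  assumes "finite D" "card D = t" "\<And>T. T \<in> \<B> \<Longrightarrow> finite T \<and> card T = t + 1 \<and> D \<subseteq> T" "\<B> \<noteq> {}"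
    and "\<And>T. T \<in> \<B> \<Longrightarrow> t \<le> card (K \<inter> T)" "\<not> D \<subseteq> K"
  shows "card (K \<inter> D) + 1 = t" "\<Union>\<B> - D \<subseteq> K"
proof -
  have "K \<inter> D \<subset> D" using assms(6) by blast
  then have lt: "card (K \<inter> D) < t" using assms psubset_card_mono by blast
  have *: "x \<in> K \<and> t \<le> card (K \<inter> D) + 1" if "x \<in> \<Union>\<B> - D" for x
  proof -
    have "insert x D \<in> \<B>" using star_family_eq(1)[OF assms(1,2,3)] that by blast
    then have le: "t \<le> card (K \<inter> insert x D)" using assms(5) by blast
    have "x \<in> K"
    proof (rule ccontr)
      assume "x \<notin> K"
      then have "K \<inter> insert x D = K \<inter> D" by blast
      then show False using le lt by simp
    qed
    moreover have "card (K \<inter> insert x D) \<le> card (insert x (K \<inter> D))"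
      using assms(1) by (intro card_mono) auto
    moreover have "card (insert x (K \<inter> D)) \<le> card (K \<inter> D) + 1"
      using assms(1) by (simp add: card_insert_if)
    ultimately show ?thesis using le by linarith
  qed
  then show "\<Union>\<B> - D \<subseteq> K" by blast
  obtain x where "x \<in> \<Union>\<B> - D" using assms(4) star_family_eq(1)[OF assms(1,2,3)] by blast
  then show "card (K \<inter> D) + 1 = t" using * lt by fastforce
qed

context cross_pair
begin

text \<open>A set \<open>S\<close> missing part of the core would have \<open>t - 1\<close> elements
  in \<open>D\<close> and at least three petal elements, more than its \<open>t + 1\<close> elements
  allow.\<close>

lemma star_core_transfer:
  assumes "D \<subseteq> V" "card D = t" "\<forall>T\<in>base \<G>. D \<subseteq> T" "3 \<le> card (base \<G>)" "S \<in> base \<F>"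
  shows "D \<subseteq> S"
proof (rule ccontr)
  assume n: "\<not> D \<subseteq> S"
  have fD: "finite D" using assms(1) by (rule finite_subset_V)
  have B: "finite T \<and> card T = t + 1 \<and> D \<subseteq> T" if "T \<in> base \<G>" for T using that baseD assms(3) by auto
  have ne: "base \<G> \<noteq> {}" using assms(4) by auto
  have cr: "t \<le> card (S \<inter> T)" if "T \<in> base \<G>" for T using base_cross[OF that assms(5)] by (simp add: Int_commute)
  note miss = star_family_miss[where \<B> = "base \<G>", OF fD assms(2) B ne cr n]
  have S: "finite S" "card S = t + 1" using baseD[OF assms(5)] by auto
  have "(S \<inter> D) \<union> (\<Union>(base \<G>) - D) \<subseteq> S" using miss(2) by blast
  then have "card ((S \<inter> D) \<union> (\<Union>(base \<G>) - D)) \<le> card S" using S by (intro card_mono)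
  moreover have "card ((S \<inter> D) \<union> (\<Union>(base \<G>) - D)) = card (S \<inter> D) + card (\<Union>(base \<G>) - D)"
    using fD finite_subset[OF miss(2) S(1)] by (intro card_Un_disjoint) auto
  moreover have "card (\<Union>(base \<G>) - D) = card (base \<G>)"
    by (rule star_family_eq(2)[where \<B> = "base \<G>", OF fD assms(2) B])
  ultimately show False using miss(1) S assms(4) by linarith
qed

text \<open>A member \<open>G\<close> of \<open>\<G>\<close> not containing \<open>D\<close> meets
  \<open>D\<close> in \<open>t - 1\<close> elements, so \<open>Z = G - D\<close> has
  \<open>m\<close> elements and contains the petals \<open>X\<close> of \<open>base \<G>\<close>.
  Members of \<open>\<F>\<close> above \<open>D\<close> meet \<open>Z\<close>: either in
  \<open>X\<close>, or in some \<open>z \<in> Z - X\<close>, where \<open>insert z D\<close> is no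
  transversal and can be branched. Members not above \<open>D\<close> miss one
  \<open>d \<in> D\<close> and contain all petals \<open>Y\<close> of
  \<open>base \<F>\<close>.\<close>

lemma star_bound:
  assumes "D \<subseteq> V" "card D = t" "\<forall>T\<in>base \<G>. D \<subseteq> T" "\<forall>S\<in>base \<F>. D \<subseteq> S"
    and "base \<G> \<noteq> {}" "base \<F> \<noteq> {}"
  shows "card (base \<G>) \<le> m"
    and "card \<F> + (m - card (base \<G>)) * N (t+1)
      \<le> hub + 2 * ((m - card (base \<G>)) * (m * N (t+2))) + t * N (t - 1 + card (base \<F>))"
proof -
  interpret sw: cross_pair n k t \<G> \<F> by (rule swapped)
  have fD: "finite D" using assms(1) by (rule finite_subset_V)
  have BG: "finite T \<and> card T = t + 1 \<and> D \<subseteq> T" if "T \<in> base \<G>" for T using that baseD assms(3) by auto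
  have BF: "finite T \<and> card T = t + 1 \<and> D \<subseteq> T" if "T \<in> base \<F>" for T using that baseD assms(4) by auto
  define X where "X = \<Union>(base \<G>) - D"
  define Y where "Y = \<Union>(base \<F>) - D"
  have X: "base \<G> = (\<lambda>x. insert x D) ` X" "card X = card (base \<G>)"
    unfolding X_def using star_family_eq[where \<B> = "base \<G>", OF fD assms(2) BG] by auto
  have Y: "card Y = card (base \<F>)"
    unfolding Y_def using star_family_eq(2)[where \<B> = "base \<F>", OF fD assms(2) BF] by auto
  have YV: "Y \<subseteq> V" unfolding Y_def using baseD by blast
  \<comment> \<open>Non-triviality says that \<open>D\<close>, having \<open>t\<close> elements, is
    not a transversal of \<open>\<G>\<close>.\<close>
  obtain G where G: "G \<in> \<G>" "\<not> D \<subseteq> G"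
  proof -
    obtain G where "G \<in> \<G>" "card (D \<inter> G) < t"
      using nontriv[OF assms(2)] assms(1) unfolding transv_def by force
    moreover have "D \<inter> G = D" if "D \<subseteq> G" using that by blast
    ultimately show thesis using that assms(2) by fastforce
  qed
  have Gk: "finite G" "card G = k" "G \<subseteq> V" using G(1) G_sub by (auto simp: nsets_def)
  have missG: "card (G \<inter> D) + 1 = t" "X \<subseteq> G"
    unfolding X_def
    using star_family_miss[where \<B> = "base \<G>", OF fD assms(2) BG assms(5) sw.base_inter_F[OF _ G(1)] G(2)] by auto
  define Z where "Z = G - D"
  have cZ: "card Z = m"
    unfolding Z_def m_def using missG(1) Gk t_less by (simp add: card_Diff_subset_Int)
  have Z: "Z \<subseteq> V" "finite Z" "D \<inter> Z = {}" "X \<subseteq> Z"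
    unfolding Z_def using Gk missG(2) X_def by auto
  have fX: "finite X" using Z finite_subset by blast
  show pm: "card (base \<G>) \<le> m" using card_mono[OF Z(2,4)] X(2) cZ by simp
  let ?p = "card (base \<G>)"
  have cZX: "card (Z - X) = m - ?p" using Z fX X(2) cZ by (simp add: card_Diff_subset)
  let ?f = "\<lambda>x. insert x D"
  let ?A = "{K \<in> nsets V k. \<exists>W\<in>?f ` X. W \<subseteq> K}"
  let ?B = "\<Union>z\<in>Z - X. {K \<in> \<F>. insert z D \<subseteq> K}"
  let ?C = "\<Union>d\<in>D. {K \<in> nsets V k. (D - {d}) \<union> Y \<subseteq> K}"
  have fin: "finite (nsets V k)" by (simp add: finite_imp_finite_nsets)
  have sub: "\<F> \<subseteq> ?A \<union> ?B \<union> ?C"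
  proof
    fix K assume K: "K \<in> \<F>"
    then have Kn: "K \<in> nsets V k" using F_sub by auto
    show "K \<in> ?A \<union> ?B \<union> ?C"
    proof (cases "D \<subseteq> K")
      case True
      have "K \<inter> Z \<noteq> {}"
      proof
        assume "K \<inter> Z = {}"
        then have "K \<inter> G \<subseteq> G \<inter> D" unfolding Z_def by blast
        then have "card (K \<inter> G) \<le> card (G \<inter> D)" using Gk by (intro card_mono) auto
        then show False using F_inter[OF K G(1)] missG(1) by linarith
      qed
      then obtain z where z: "z \<in> K" "z \<in> Z" by blast
      then have zK: "insert z D \<subseteq> K" using True by simp
      show ?thesis
      proof (cases "z \<in> X")
        case True
        then have "K \<in> ?A" using zK Kn by auto
        then show ?thesis by (intro UnI1)
      next
        case False
        then have "K \<in> ?B" using zK z(2) K by (intro UN_I[of z]) auto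
        then show ?thesis by (intro UnI1 UnI2)
      qed
    next
      case False
      note miss = star_family_miss[where \<B> = "base \<F>", OF fD assms(2) BF assms(6) base_inter_F[OF _ K] False]
      obtain d where d: "d \<in> D" "d \<notin> K" using False by blast
      have "card (D - {d}) \<le> card (K \<inter> D)" using miss(1) d assms(2) fD by simp
      then have "K \<inter> D = D - {d}" using d fD by (intro card_seteq) auto
      then have "(D - {d}) \<union> Y \<subseteq> K" using miss(2) unfolding Y_def by blast
      then have "K \<in> ?C" using Kn d(1) by (intro UN_I[of d]) auto
      then show ?thesis by (intro UnI2)
    qed
  qed
  have cB: "card ?B \<le> (m - ?p) * (m * N (t+2))"
  proof -
    have "card ?B \<le> (\<Sum>z\<in>Z - X. card {K \<in> \<F>. insert z D \<subseteq> K})" using Z(2) by (intro card_UN_le) simp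
    also have "\<dots> \<le> (\<Sum>z\<in>Z - X. m * N (t+2))"
    proof (rule sum_mono)
      fix z assume z: "z \<in> Z - X"
      then have zD: "z \<notin> D" "z \<in> V" using Z by auto
      then have W: "insert z D \<subseteq> V" "card (insert z D) = t + 1" using assms(1,2) fD by auto
      have "insert z D \<notin> base \<G>"
      proof
        assume "insert z D \<in> base \<G>"
        then have "z \<in> X" using zD unfolding X_def by blast
        then show False using z by blast
      qed
      then have nt: "\<not> transv \<G> (insert z D)" using W unfolding base_def by simp
      have "card {K \<in> \<F>. insert z D \<subseteq> K} \<le> m ^ 1 * N (card (insert z D) + 1)"
      proof (rule F_branch)
        fix U' assume U: "insert z D \<subseteq> U'" "U' \<subseteq> V" "card U' < card (insert z D) + 1"
        then have "insert z D = U'" using finite_subset_V[OF U(2)] by (intro card_seteq) auto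
        then show "\<not> transv \<G> U'" using nt by simp
      qed (use W in auto)
      then show "card {K \<in> \<F>. insert z D \<subseteq> K} \<le> m * N (t+2)" unfolding W(2) by simp
    qed
    also have "\<dots> = (m - ?p) * (m * N (t+2))" using cZX by simp
    finally show ?thesis .
  qed
  have cC: "card ?C \<le> t * N (t - 1 + card (base \<F>))"
  proof -
    have "card ?C \<le> (\<Sum>d\<in>D. card {K \<in> nsets V k. (D - {d}) \<union> Y \<subseteq> K})" using fD by (rule card_UN_le)
    also have "\<dots> = (\<Sum>d\<in>D. N (t - 1 + card (base \<F>)))"
    proof (rule sum.cong)
      fix d assume d: "d \<in> D"
      have fY: "finite Y" using YV by (rule finite_subset_V)
      have "card ((D - {d}) \<union> Y) = card (D - {d}) + card Y"
        using fD fY unfolding Y_def by (intro card_Un_disjoint) auto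
      also have "\<dots> = t - 1 + card (base \<F>)" using d fD assms(2) Y by simp
      finally have c: "card ((D - {d}) \<union> Y) = t - 1 + card (base \<F>)" .
      have "(D - {d}) \<union> Y \<subseteq> V" using assms(1) YV by blast
      from card_above[OF this] show "card {K \<in> nsets V k. (D - {d}) \<union> Y \<subseteq> K} = N (t - 1 + card (base \<F>))"
        unfolding c .
    qed simp
    also have "\<dots> = t * N (t - 1 + card (base \<F>))" using assms(2) by simp
    finally show ?thesis .
  qed
  \<comment> \<open>The generators from \<open>X\<close> and from \<open>Z - X\<close> together give
    a family of size exactly \<open>hub\<close>, so each of the \<open>m - ?p\<close> generators
    outside \<open>X\<close> counts as a loss of about \<open>N (t+1)\<close>. Its error term and
    the one in \<open>cB\<close> explain the factor 2 in the conclusion.\<close>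
  have cA: "card ?A + (m - ?p) * N (t+1) \<le> hub + (m - ?p) * (m * N (t+2))"
  proof -
    let ?X = "?f ` X" and ?Y = "?f ` (Z - X)"
    have inj: "inj_on ?f Z" using Z(3) by (intro inj_onI) blast
    have cX: "card ?X = ?p" using X by simp
    have cY: "card ?Y = m - ?p" using cZX card_image[OF inj_on_subset[OF inj]] by (metis Diff_subset)
    have un: "?X \<union> ?Y = ?f ` Z" using Z(4) by blast
    have "card {K \<in> nsets V k. \<exists>W\<in>?X. W \<subseteq> K} + card ?Y * N (t+1)
      \<le> card {K \<in> nsets V k. \<exists>W\<in>?X \<union> ?Y. W \<subseteq> K} + card ?Y * (m * N (Suc (t+1)))"
    proof (rule card_up_union)
      show "finite ?X" "finite ?Y" using fX Z(2) by auto
      show "?X \<inter> ?Y = {}" using inj Z(4) by (auto dest: inj_onD)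
      show "card ?X + card ?Y \<le> m" using cX cY pm by simp
      fix W assume "W \<in> ?X \<union> ?Y"
      then obtain z where z: "z \<in> Z" "W = insert z D" using un by blast
      then have "z \<notin> D" "z \<in> V" using Z by auto
      then show "W \<subseteq> V \<and> card W = t + 1" using z assms(1,2) fD by auto
    qed
    moreover have "card {K \<in> nsets V k. \<exists>W\<in>?f ` Z. W \<subseteq> K} = hub"
      using assms(1,2) Z cZ by (intro card_star_meeting)
    ultimately show ?thesis unfolding un cY by simp
  qed
  have "card \<F> \<le> card (?A \<union> ?B \<union> ?C)"
    using sub fin Z(2) fD by (intro card_mono) auto
  also have "\<dots> \<le> card (?A \<union> ?B) + card ?C" by (rule card_Un_le)
  also have "\<dots> \<le> card ?A + card ?B + card ?C" by (intro add_right_mono card_Un_le)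
  finally show "card \<F> + (m - ?p) * N (t+1)
      \<le> hub + 2 * ((m - ?p) * (m * N (t+2))) + t * N (t - 1 + card (base \<F>))"
    using cA cB cC by linarith
qed

end

section \<open>Numerical estimates\<close>

text \<open>Here \<open>c\<close> stands for \<open>N (t+1)\<close>, and \<open>M/12\<close> is the
  relative error of the covering bounds. The polynomial inequality is proved by expanding the
  difference around \<open>M = 4\<close>, where all coefficients are positive;
  \<open>product_bound_grid\<close> works in the same way.\<close>

lemma product_bound_few:
  fixes f g c M p s :: real
  assumes "0 \<le> c" "4 \<le> M" "0 \<le> g" "f \<le> (p + M/12) * c" "g \<le> (s + M/12) * c" "p \<le> 2 * M - 2" "s \<le> 2"
  shows "18 * (f * g) \<le> 17 * (M * c)^2"
proof -
  have f: "f \<le> (25/12 * M - 2) * c"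
    using assms(4) mult_right_mono[of "p + M/12" "25/12 * M - 2" c] assms by linarith
  have g: "g \<le> (2 + M/12) * c"
    using assms(5) mult_right_mono[of "s + M/12" "2 + M/12" c] assms by linarith
  have "f * g \<le> ((25/12 * M - 2) * c) * ((2 + M/12) * c)"
    using f g assms by (intro mult_mono) auto
  moreover have "18 * ((25/12 * M - 2) * (2 + M/12)) \<le> 17 * M^2"
  proof -
    have eq: "17 * M^2 - 18 * ((25/12 * M - 2) * (2 + M/12)) = 6 + 39 * (M - 4) + 111/8 * (M - 4)^2"
      by (simp add: power2_eq_square field_simps)
    have "0 \<le> 17 * M^2 - 18 * ((25/12 * M - 2) * (2 + M/12))" unfolding eq using assms(2) by (intro add_nonneg_nonneg) auto
    then show ?thesis by (simp only: diff_ge_0_iff_ge)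
  qed
  then have "18 * ((25/12 * M - 2) * (2 + M/12)) * c^2 \<le> 17 * M^2 * c^2" by (rule mult_right_mono) simp
  ultimately show ?thesis by (simp add: power2_eq_square algebra_simps)
qed

lemma product_bound_grid:
  fixes f g c M p s :: real
  assumes "0 \<le> c" "4 \<le> M" "0 \<le> g" "f \<le> (p + M/12) * c" "g \<le> (s + M/12) * c" "p \<le> 3" "s \<le> 4"
  shows "18 * (f * g) \<le> 17 * (M * c)^2"
proof -
  have f: "f \<le> (3 + M/12) * c"
    using assms(4) mult_right_mono[of "p + M/12" "3 + M/12" c] assms by linarith
  have g: "g \<le> (4 + M/12) * c"
    using assms(5) mult_right_mono[of "s + M/12" "4 + M/12" c] assms by linarith
  have "f * g \<le> ((3 + M/12) * c) * ((4 + M/12) * c)"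
    using f g assms by (intro mult_mono) auto
  moreover have "18 * ((3 + M/12) * (4 + M/12)) \<le> 17 * M^2"
  proof -
    have eq: "17 * M^2 - 18 * ((3 + M/12) * (4 + M/12)) = 12 + 249/2 * (M - 4) + 135/8 * (M - 4)^2"
      by (simp add: power2_eq_square field_simps)
    have "0 \<le> 17 * M^2 - 18 * ((3 + M/12) * (4 + M/12))" unfolding eq using assms(2) by (intro add_nonneg_nonneg) auto
    then show ?thesis by (simp only: diff_ge_0_iff_ge)
  qed
  then have "18 * ((3 + M/12) * (4 + M/12)) * c^2 \<le> 17 * M^2 * c^2" by (rule mult_right_mono) simp
  ultimately show ?thesis by (simp add: power2_eq_square algebra_simps)
qed

text \<open>Used with \<open>x = t + 2\<close>. For \<open>m = x = M\<close> the bound on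
  \<open>f * g\<close> approaches \<open>(M * c)^2\<close> as \<open>x\<close> grows, so a fixed
  factor like 17/18 does not suffice. After replacing \<open>m * x\<close> and \<open>m^2\<close> by
  \<open>M^2\<close>, the remaining gap is
  \<open>(4*x^2 - 1) * (2*x - 1) / (16*x^4)\<close>.\<close>

lemma product_bound_single:
  fixes f g c M m x :: real
  assumes "0 \<le> c" "3 \<le> x" "0 \<le> m" "m \<le> M" "x \<le> M" "0 \<le> g"
    and "f \<le> ((x - 1) * m + m / (4*x)) * c" "g \<le> (1 + m / (2*x^2)) * c"
  shows "f * g \<le> (M * c)^2 * (1 - 1/(4*x^2))^2"
proof -
  have x: "0 < x" using assms by simp
  have mx: "m * x \<le> M^2" using mult_mono[of m M x M] assms by (simp add: power2_eq_square)
  have mm: "m^2 \<le> M^2" using assms by (intro power_mono) auto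
  have "((x - 1) * m + m / (4*x)) * (1 + m / (2*x^2))
      = (m * x) * (1 - 1/x + 1/(4*x^2)) + m^2 * ((x-1)/(2*x^2) + 1/(8*x^3))"
    using x by (simp add: field_simps power2_eq_square power3_eq_cube)
  also have "\<dots> \<le> M^2 * (1 - 1/x + 1/(4*x^2)) + M^2 * ((x-1)/(2*x^2) + 1/(8*x^3))"
  proof (intro add_mono mult_right_mono mx mm)
    have "1/x \<le> 1" using assms x by simp
    then show "0 \<le> 1 - 1/x + 1/(4*x^2)" by (smt (verit) zero_le_divide_1_iff zero_le_mult_iff zero_le_power2)
    show "0 \<le> (x-1)/(2*x^2) + 1/(8*x^3)" using assms by simp
  qed
  also have "\<dots> = M^2 * (1 - 1/x + 1/(4*x^2) + (x-1)/(2*x^2) + 1/(8*x^3))" by (simp add: algebra_simps)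
  also have "\<dots> \<le> M^2 * (1 - 1/(4*x^2))^2"
  proof (rule mult_left_mono)
    have eq: "(1 - 1/(4*x^2))^2 - (1 - 1/x + 1/(4*x^2) + (x-1)/(2*x^2) + 1/(8*x^3))
        = (8*x^3 - 4*x^2 - 2*x + 1) / (16 * x^4)"
      using x by (simp add: field_simps power2_eq_square power3_eq_cube power4_eq_xxxx)
    have "0 \<le> 8*x^3 - 4*x^2 - 2*x + 1"
    proof -
      have "8*x^3 - 4*x^2 - 2*x + 1 = (4*x^2 - 1) * (2*x - 1)" by (simp add: algebra_simps power2_eq_square power3_eq_cube)
      moreover have "0 \<le> 4*x^2 - 1" "0 \<le> 2*x - 1" using assms one_le_power[of x 2] by linarith+
      ultimately show ?thesis by (simp only: mult_nonneg_nonneg)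
    qed
    then have "0 \<le> (8*x^3 - 4*x^2 - 2*x + 1) / (16 * x^4)" using x by (intro divide_nonneg_nonneg) auto
    then show "1 - 1/x + 1/(4*x^2) + (x-1)/(2*x^2) + 1/(8*x^3) \<le> (1 - 1/(4*x^2))^2"
      unfolding eq[symmetric] by (simp only: diff_ge_0_iff_ge)
  qed simp
  finally have key: "((x - 1) * m + m / (4*x)) * (1 + m / (2*x^2)) \<le> M^2 * (1 - 1/(4*x^2))^2" .
  have "f * g \<le> (((x - 1) * m + m / (4*x)) * c) * ((1 + m / (2*x^2)) * c)"
    using assms x by (intro mult_mono) auto
  also have "\<dots> = (((x - 1) * m + m / (4*x)) * (1 + m / (2*x^2))) * c^2" by (simp add: power2_eq_square)
  also have "\<dots> \<le> (M^2 * (1 - 1/(4*x^2))^2) * c^2" using key by (rule mult_right_mono) simp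
  finally show ?thesis by (simp add: power_mult_distrib ac_simps)
qed

section \<open>Extremal sizes and error terms in units of \<open>N (t+1)\<close>\<close>

context cross_params
begin

text \<open>To leading order \<open>\<H> n k t\<close> has \<open>m * N (t+1)\<close> members and
  \<open>\<A> n k t\<close> has \<open>(t + 2) * N (t+1)\<close>, so \<open>M\<close> is the leading
  coefficient of the larger one.\<close>

definition M :: nat where "M = max m (t + 2)"

lemma M_facts: "m \<le> M" "t + 2 \<le> M" "4 \<le> M" "m + t \<le> 2 * M - 2"
proof -
  show *: "m \<le> M" "t + 2 \<le> M" unfolding M_def by auto
  \<comment> \<open>Both follow from \<open>m + (t + 2) = k + 3\<close>: this sum is at least 8 and
    at most \<open>2 * M\<close>.\<close>
  show "4 \<le> M" "m + t \<le> 2 * M - 2" using * m_t k_ge by linarith+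
qed

lemma N_decay_real: "real (N (Suc u)) * (4 * (real t + 2)^2 * real k) \<le> real (N u)"
proof -
  have "real (N (Suc u) * (4 * (t + 2)^2 * k)) \<le> real (N u)" using N_decay by (simp only: of_nat_le_iff)
  then show ?thesis by (simp only: of_nat_mult of_nat_add of_nat_power of_nat_numeral)
qed

text \<open>The case \<open>t + 1 = k\<close> is separate because there \<open>M = k + 1\<close>
  exceeds \<open>k\<close>; but then \<open>N (t+2)\<close> vanishes.\<close>

lemma M_N_le: "real M * real (N (t+2)) * (4 * (real t + 2)^2) \<le> real (N (t+1))"
proof (cases "t + 1 = k")
  case True
  then have "N (t+2) = 0" by (simp add: N_def)
  then show ?thesis by simp
next
  case False
  then have "M \<le> k" using m_le t_less unfolding M_def by auto
  then have "real M * (real (N (t+2)) * (4 * (real t + 2)^2)) \<le> real k * (real (N (t+2)) * (4 * (real t + 2)^2))"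
    by (intro mult_right_mono) auto
  then show ?thesis using N_decay_real[of "t+1"] by (simp add: ac_simps)
qed

text \<open>The family that attains \<open>M\<close> is large enough: \<open>\<H> n k t\<close> if
  \<open>M = m\<close>, and \<open>\<A> n k t\<close> otherwise. Its Bonferroni loss
  \<open>M * (M * N (t+2))\<close> is controlled by \<open>M_N_le\<close>.\<close>

lemma extremal_ge:
  "(real M * real (N (t+1)))^2 * (1 - 1 / (4 * (real t + 2)^2))^2
     \<le> real (max ((card (\<A> n k t))^2) ((card (\<H> n k t))^2))"
proof -
  let ?c = "real (N (t+1))" and ?d = "real (N (t+2))" and ?x = "real t + 2"
  have ex: "\<exists>h. real M * ?c - real M * (real M * ?d) \<le> real h \<and> h^2 \<le> max ((card (\<A> n k t))^2) ((card (\<H> n k t))^2)"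
  proof (cases "M = m")
    case True
    have "m * N (t+1) \<le> card (\<H> n k t) + m * (m * N (t+2))" using hub_ge card_H by simp
    then have "real (m * N (t+1)) \<le> real (card (\<H> n k t) + m * (m * N (t+2)))" by (simp only: of_nat_le_iff)
    then show ?thesis unfolding True by (intro exI[of _ "card (\<H> n k t)"]) simp
  next
    case False
    then have M: "M = t + 2" unfolding M_def by auto
    have "real ((t + 2) * N (t+1)) \<le> real (card (\<A> n k t) + (t + 2) * ((t + 2) * N (t+2)))"
      using card_A_ge by (simp only: of_nat_le_iff)
    then have "real (t + 2) * ?c - real (t + 2) * (real (t + 2) * ?d) \<le> real (card (\<A> n k t))"
      unfolding of_nat_mult of_nat_add by linarith
    then show ?thesis unfolding M by (intro exI[of _ "card (\<A> n k t)"] conjI max.cobounded1)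
  qed
  then obtain h where h: "real M * ?c - real M * (real M * ?d) \<le> real h"
    "h^2 \<le> max ((card (\<A> n k t))^2) ((card (\<H> n k t))^2)" by blast
  have x: "0 < 4 * ?x^2" by simp
  have "real M * ?d \<le> ?c / (4 * ?x^2)"
    using M_N_le by (simp only: pos_le_divide_eq[OF x])
  then have "real M * (real M * ?d) \<le> real M * (?c / (4 * ?x^2))" by (rule mult_left_mono) simp
  then have le: "real M * ?c * (1 - 1 / (4 * ?x^2)) \<le> real h" using h(1) by (simp add: algebra_simps)
  have "1 \<le> 4 * ?x^2" using one_le_power[of ?x 2] by linarith
  then have "1 / (4 * ?x^2) \<le> 1" by (simp only: divide_le_eq_1_pos[OF x])
  then have "0 \<le> real M * ?c * (1 - 1 / (4 * ?x^2))" by (intro mult_nonneg_nonneg) auto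
  then have "(real M * ?c * (1 - 1 / (4 * ?x^2)))^2 \<le> (real h)^2" using le by (intro power_mono)
  also have "\<dots> = real (h^2)" by simp
  also have "\<dots> \<le> real (max ((card (\<A> n k t))^2) ((card (\<H> n k t))^2))" using h(2) by (simp only: of_nat_le_iff)
  finally show ?thesis by (simp only: power_mult_distrib)
qed

lemma extremal_I:
  assumes "real f * real g \<le> (real M * real (N (t+1)))^2 * (1 - 1 / (4 * (real t + 2)^2))^2"
  shows "f * g \<le> max ((card (\<A> n k t))^2) ((card (\<H> n k t))^2)"
proof -
  have "real (f * g) \<le> real (max ((card (\<A> n k t))^2) ((card (\<H> n k t))^2))"
    using assms extremal_ge by simp
  then show ?thesis by (simp only: of_nat_le_iff)
qed

text \<open>Since \<open>t\<close> is at least 1, the loss \<open>1 / (4 * (t + 2)^2)\<close> is at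
  most 1/36, and \<open>(35/36)^2\<close> exceeds 17/18.\<close>

lemma extremal_I18:
  assumes "18 * (real f * real g) \<le> 17 * (real M * real (N (t+1)))^2"
  shows "f * g \<le> max ((card (\<A> n k t))^2) ((card (\<H> n k t))^2)"
proof (rule extremal_I)
  have "3^2 \<le> (real t + 2)^2" using t_pos by (intro power_mono) auto
  then have "1 / (4 * (real t + 2)^2) \<le> 1 / 36" by (intro divide_left_mono) auto
  then have "(35/36)^2 \<le> (1 - 1 / (4 * (real t + 2)^2))^2" by (intro power_mono) auto
  then have "17/18 \<le> (1 - 1 / (4 * (real t + 2)^2))^2" by (simp add: power2_eq_square)
  then have "(real M * real (N (t+1)))^2 * (17/18) \<le> (real M * real (N (t+1)))^2 * (1 - 1 / (4 * (real t + 2)^2))^2"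
    by (rule mult_left_mono) simp
  then show "real f * real g \<le> (real M * real (N (t+1)))^2 * (1 - 1 / (4 * (real t + 2)^2))^2"
    using assms by linarith
qed

text \<open>The second term of \<open>F_cover_t\<close> for \<open>a = 1\<close>. The factor
  \<open>(t + 1) * m\<close> is absorbed by one application of \<open>N_decay\<close>, which has
  \<open>(t + 2)^2 * k\<close> to spare.\<close>

lemma error_one: "real (((t + 1) choose t) * m * m * N (t+2)) \<le> real m / (4 * (real t + 2)) * real (N (t+1))"
proof -
  let ?x = "real t + 2" and ?d = "real (N (t+2))"
  have "real (((t + 1) choose t) * m * m * N (t+2)) = (real t + 1) * real m * (real m * ?d)"
    by (simp add: algebra_simps)
  also have "\<dots> \<le> ?x * real m * (real k * ?d)"
    using m_le by (intro mult_mono) auto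
  also have "\<dots> = real m / (4 * ?x) * (?d * (4 * ?x^2 * real k))" by (simp add: field_simps power2_eq_square)
  also have "\<dots> \<le> real m / (4 * ?x) * real (N (t+1))"
    using N_decay_real[of "t+1"] by (intro mult_left_mono) auto
  finally show ?thesis .
qed

lemma error_one_M: "real m / (4 * (real t + 2)) \<le> real M / 12"
  using M_facts(1) t_pos by (intro frac_le) auto

text \<open>The second term of \<open>F_cover_two\<close>. Since \<open>m + 2 * t\<close> is at most
  \<open>2 * k\<close>, the full factor \<open>(t + 2)^2\<close> is gained here, one power of
  \<open>t + 2\<close> more than in \<open>error_one\<close>.\<close>

lemma error_two: "real ((m + 2 * t) * m * N (t+2)) \<le> real m / (2 * (real t + 2)^2) * real (N (t+1))"
proof -
  let ?x = "real t + 2" and ?d = "real (N (t+2))"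
  have "m + 2 * t \<le> 2 * k" using m_t t_less by linarith
  then have "real (m + 2 * t) \<le> 2 * real k" by linarith
  then have "real (m + 2 * t) * (real m * ?d) \<le> 2 * real k * (real m * ?d)"
    by (rule mult_right_mono) simp
  then have "real ((m + 2 * t) * m * N (t+2)) \<le> 2 * real k * (real m * ?d)" by (simp add: ac_simps)
  also have "\<dots> = real m / (2 * ?x^2) * (?d * (4 * ?x^2 * real k))" by (simp add: field_simps)
  also have "\<dots> \<le> real m / (2 * ?x^2) * real (N (t+1))"
    using N_decay_real[of "t+1"] by (intro mult_left_mono) auto
  finally show ?thesis .
qed

lemma choose_two_real: "real ((t + 2) choose t) = (real t + 2) * (real t + 1) / 2"
proof -
  have "2 * ((t + 2) choose t) = (t + 2) * (t + 1)"
    using binomial_absorb_comp[of "t + 2" t] by simp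
  then have "real (2 * ((t + 2) choose t)) = real ((t + 2) * (t + 1))" by (rule arg_cong)
  then have "2 * real ((t + 2) choose t) = (real t + 2) * (real t + 1)"
    by (simp only: of_nat_mult of_nat_add of_nat_1 of_nat_numeral)
  then show ?thesis by simp
qed

lemma error_three: "real (((t + 2) choose t) * m * m * N (t+2)) \<le> real m / 8 * real (N (t+1))"
proof -
  let ?x = "real t + 2" and ?d = "real (N (t+2))"
  have "real (((t + 2) choose t) * m * m * N (t+2)) = (?x * (real t + 1) / 2) * real m * (real m * ?d)"
    using choose_two_real by simp
  also have "\<dots> \<le> (?x * ?x / 2) * real m * (real k * ?d)"
    using m_le by (intro mult_mono divide_right_mono) auto
  also have "\<dots> = real m / 8 * (?d * (4 * ?x^2 * real k))" by (simp add: field_simps power2_eq_square)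
  also have "\<dots> \<le> real m / 8 * real (N (t+1))"
    using N_decay_real[of "t+1"] by (intro mult_left_mono) auto
  finally show ?thesis .
qed

definition \<phi> :: "nat \<Rightarrow> nat" where "\<phi> a = ((t + a) choose t) * m ^ a * N (t + a)"

text \<open>From \<open>a\<close> to \<open>a + 1\<close> the binomial coefficient grows by the
  factor \<open>(t + a + 1) / (a + 1)\<close>, at most \<open>t + 1\<close>, and the power of
  \<open>m\<close> by \<open>m\<close>; the decay of \<open>N\<close> outweighs both.\<close>

lemma phi_Suc_le: "\<phi> (Suc a) \<le> \<phi> a"
proof -
  have "Suc (t + a) choose t \<le> (t + 1) * ((t + a) choose t)"
  proof -
    have "(Suc (t + a) choose t) * Suc a = Suc (t + a) * ((t + a) choose t)"
      using binomial_absorb_comp[of "Suc (t + a)" t] by (simp add: ac_simps)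
    also have "\<dots> \<le> (Suc a * (t + 1)) * ((t + a) choose t)" by (intro mult_le_mono1) simp
    finally have "Suc a * (Suc (t + a) choose t) \<le> Suc a * ((t + 1) * ((t + a) choose t))"
      by (simp only: ac_simps)
    then show ?thesis by (simp only: Suc_mult_le_cancel1)
  qed
  then have "\<phi> (Suc a) \<le> (t + 1) * ((t + a) choose t) * m ^ Suc a * N (Suc (t + a))"
    unfolding \<phi>_def by (simp only: add_Suc_right mult_le_mono1)
  also have "\<dots> = ((t + a) choose t) * m ^ a * (N (Suc (t + a)) * ((t + 1) * m))" by (simp add: algebra_simps)
  also have "\<dots> \<le> ((t + a) choose t) * m ^ a * (N (Suc (t + a)) * (4 * (t + 2)^2 * k))"
  proof (intro mult_le_mono2 mult_le_mono m_le)
    show "t + 1 \<le> 4 * (t + 2)^2" by (simp add: power2_eq_square)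
  qed
  also have "\<dots> \<le> ((t + a) choose t) * m ^ a * N (t + a)" using N_decay by (rule mult_le_mono2)
  finally show ?thesis unfolding \<phi>_def .
qed

lemma phi_mono: "a \<le> b \<Longrightarrow> \<phi> b \<le> \<phi> a"
  using phi_Suc_le by (rule lift_Suc_antimono_le)

lemma phi_two: "real (\<phi> 2) \<le> real m / 8 * real (N (t+1))"
  using error_three unfolding \<phi>_def by (simp add: power2_eq_square ac_simps)

text \<open>The decay from \<open>N (t+2)\<close> to \<open>N (t+3)\<close> absorbs the factor
  \<open>t + 1\<close> of \<open>\<phi> 1\<close> together with a factor \<open>(t + 2) * m\<close>
  of \<open>\<phi> 3\<close>. What remains is \<open>m * N (t+1) * \<phi> 2\<close>.\<close>

lemma phi_one_three: "real (\<phi> 1) * real (\<phi> 3) \<le> (real m * real (N (t+1)))^2 / 2"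
proof -
  let ?x = "real t + 2" and ?c = "real (N (t+1))" and ?e = "real (N (t+3))"
  have c3: "real ((t + 3) choose t) \<le> ?x * ((t + 2) choose t)"
  proof -
    have "(Suc (t + 2) choose t) * 3 = Suc (t + 2) * ((t + 2) choose t)"
      using binomial_absorb_comp[of "Suc (t + 2)" t] by (simp add: ac_simps)
    then have "real ((Suc (t + 2) choose t) * 3) = real (Suc (t + 2) * ((t + 2) choose t))" by (rule arg_cong)
    moreover have "real (Suc (t + 2)) = real t + 3" by simp
    ultimately have "real (Suc (t + 2) choose t) * 3 = (real t + 3) * real ((t + 2) choose t)"
      by (simp only: of_nat_mult of_nat_numeral)
    moreover have "(real t + 3) * real ((t + 2) choose t) \<le> (3 * ?x) * real ((t + 2) choose t)"
      by (intro mult_right_mono) auto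
    moreover have "t + 3 = Suc (t + 2)" by simp
    ultimately show ?thesis by (simp only:)
  qed
  have e: "?e * (4 * ?x^2 * real k) \<le> real (N (t+2))" using N_decay_real[of "t+2"] by (simp add: eval_nat_numeral)
  have "real (\<phi> 3) = real ((t + 3) choose t) * (real m ^ 3 * ?e)" unfolding \<phi>_def by simp
  also have "\<dots> \<le> (?x * ((t + 2) choose t)) * (real m ^ 3 * ?e)" using c3 by (rule mult_right_mono) simp
  finally have p3: "real (\<phi> 3) \<le> (?x * ((t + 2) choose t)) * (real m ^ 3 * ?e)" .
  have "real (\<phi> 1) = (real t + 1) * real m * ?c" unfolding \<phi>_def by (simp add: algebra_simps)
  then have "real (\<phi> 1) * real (\<phi> 3) \<le> ((real t + 1) * real m * ?c) * ((?x * ((t + 2) choose t)) * (real m ^ 3 * ?e))"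
    using p3 by (simp only: mult_left_mono mult_nonneg_nonneg of_nat_0_le_iff add_nonneg_nonneg zero_le_one)
  also have "\<dots> = (((t + 2) choose t) * real m ^ 2) * (real m * ?c) * (?e * (?x * (real t + 1) * real m))"
    by (simp add: power2_eq_square power3_eq_cube ac_simps)
  also have "\<dots> \<le> (((t + 2) choose t) * real m ^ 2) * (real m * ?c) * (?e * (4 * ?x^2 * real k))"
  proof (intro mult_left_mono)
    have "?x * (real t + 1) \<le> 4 * ?x^2" by (simp add: power2_eq_square algebra_simps)
    then show "?x * (real t + 1) * real m \<le> 4 * ?x^2 * real k" by (rule mult_mono) (use m_le in auto)
  qed auto
  also have "\<dots> \<le> (((t + 2) choose t) * real m ^ 2) * (real m * ?c) * real (N (t+2))"
    using e by (intro mult_left_mono) auto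
  also have "\<dots> = real m * ?c * real (\<phi> 2)" unfolding \<phi>_def by simp
  also have "\<dots> \<le> real m * ?c * (real m / 8 * ?c)" using phi_two by (intro mult_left_mono) auto
  also have "\<dots> \<le> (real m * ?c)^2 / 2" by (simp add: power2_eq_square)
  finally show ?thesis .
qed

end

section \<open>The product bound\<close>

context cross_pair
begin

text \<open>If the two sets share \<open>t\<close> elements, a member of \<open>base \<G>\<close>
  contains a set of the \<open>m + t\<close> element cover and, having the same size, equals it.
  Otherwise they form a far pair, and the grid leaves at most four possibilities.\<close>

lemma card_base_le_two:
  assumes "card (base \<F>) = 2" "base \<G> \<noteq> {}"
  shows "card (base \<G>) \<le> 2 * M - 2"
proof -
  interpret sw: cross_pair n k t \<G> \<F> by (rule swapped)
  obtain S\<^sub>1 S\<^sub>2 where S: "S\<^sub>1 \<in> base \<F>" "S\<^sub>2 \<in> base \<F>" "S\<^sub>1 \<noteq> S\<^sub>2"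
    using assms(1) by (auto simp: card_2_iff)
  show ?thesis
  proof (cases "card (S\<^sub>1 \<inter> S\<^sub>2) = t")
    case True
    then obtain \<W> where W: "finite \<W>" "card \<W> \<le> m + t" "\<And>W. W \<in> \<W> \<Longrightarrow> W \<subseteq> V \<and> card W = t + 1"
      "\<And>K. transv \<G> K \<Longrightarrow> t \<le> card (K \<inter> S\<^sub>1) \<Longrightarrow> t \<le> card (K \<inter> S\<^sub>2) \<Longrightarrow> \<exists>W\<in>\<W>. W \<subseteq> K"
      using two_base_cover[OF S] by blast
    have "base \<G> \<subseteq> \<W>"
    proof
      fix T assume T: "T \<in> base \<G>"
      then obtain W' where W': "W' \<in> \<W>" "W' \<subseteq> T"
        using W(4)[of T] base_cross[OF T] S baseD[OF T] by blast
      then have "W' = T" using W(3)[OF W'(1)] baseD[OF T] by (intro card_seteq) auto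
      then show "T \<in> \<W>" using W' by simp
    qed
    then have "card (base \<G>) \<le> card \<W>" using W(1) by (intro card_mono)
    then show ?thesis using W(2) M_facts(4) by linarith
  next
    case False
    have "card (S\<^sub>1 \<inter> S\<^sub>2) < t"
    proof -
      have S1: "finite S\<^sub>1" "card S\<^sub>1 = t + 1" "finite S\<^sub>2" "card S\<^sub>2 = t + 1" using S baseD by auto
      then have "S\<^sub>1 \<inter> S\<^sub>2 \<subset> S\<^sub>1" using S(3) by (metis Int_lower1 Int_lower2 card_subset_eq psubsetI)
      then have "card (S\<^sub>1 \<inter> S\<^sub>2) < t + 1" using S1 psubset_card_mono[of S\<^sub>1 "S\<^sub>1 \<inter> S\<^sub>2"] by simp
      then show ?thesis using False by simp
    qed
    then have "card (base \<G>) \<le> 4" using sw.base_far_pair(1)[OF S(1,2)] assms(2) by simp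
    then show ?thesis using M_facts(3) by linarith
  qed
qed

lemma F_real_one:
  assumes "base \<F> \<noteq> {}"
  shows "real (card \<F>) \<le> (real (card (base \<G>)) + real m / (4 * (real t + 2))) * real (N (t+1))"
proof -
  obtain S where "S \<in> base \<F>" using assms by blast
  then have "transv \<F> S" "card S = t + 1" using baseD by auto
  from F_cover_t[OF this]
  have "real (card \<F>) \<le> real (card (base \<G>) * N (t+1) + ((t + 1) choose t) * m * m * N (t+2))"
    by (simp only: of_nat_le_iff)
  also have "\<dots> = real (card (base \<G>)) * real (N (t+1)) + real (((t + 1) choose t) * m * m * N (t+2))"
    by (simp only: of_nat_add of_nat_mult)
  also have "\<dots> \<le> real (card (base \<G>)) * real (N (t+1)) + real m / (4 * (real t + 2)) * real (N (t+1))"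
    using error_one by (rule add_left_mono)
  finally show ?thesis by (simp only: distrib_right)
qed

lemma F_real_one_M:
  assumes "base \<F> \<noteq> {}"
  shows "real (card \<F>) \<le> (real (card (base \<G>)) + real M / 12) * real (N (t+1))"
proof -
  have "(real (card (base \<G>)) + real m / (4 * (real t + 2))) * real (N (t+1))
      \<le> (real (card (base \<G>)) + real M / 12) * real (N (t+1))"
    using error_one_M by (intro mult_right_mono add_left_mono) auto
  then show ?thesis using F_real_one[OF assms] by linarith
qed

lemma F_real_two:
  assumes "2 \<le> card (base \<F>)"
  shows "real (card \<F>) \<le> (real (card (base \<G>)) + real m / (2 * (real t + 2)^2)) * real (N (t+1))"
proof -
  from F_cover_two[OF assms]
  have "real (card \<F>) \<le> real (card (base \<G>) * N (t+1) + (m + 2 * t) * m * N (t+2))"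
    by (simp only: of_nat_le_iff)
  also have "\<dots> = real (card (base \<G>)) * real (N (t+1)) + real ((m + 2 * t) * m * N (t+2))"
    by (simp only: of_nat_add of_nat_mult)
  also have "\<dots> \<le> real (card (base \<G>)) * real (N (t+1)) + real m / (2 * (real t + 2)^2) * real (N (t+1))"
    using error_two by (rule add_left_mono)
  finally show ?thesis by (simp only: distrib_right)
qed

text \<open>The main terms are \<open>(t + 1) * m\<close> for \<open>\<F>\<close> and 1 for
  \<open>\<G>\<close>, whose product can come close to \<open>M^2\<close>. Two elements of
  \<open>base \<G>\<close> give \<open>\<G>\<close> the sharper error of \<open>error_two\<close>;
  if there is only one, both main coefficients are 1 and the crude estimate suffices.\<close>

lemma bound_single_base:
  assumes s: "card (base \<F>) = 1" and p: "base \<G> \<noteq> {}"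
  shows "card \<F> * card \<G> \<le> max ((card (\<A> n k t))^2) ((card (\<H> n k t))^2)"
proof -
  interpret sw: cross_pair n k t \<G> \<F> by (rule swapped)
  have ne: "base \<F> \<noteq> {}" using s by auto
  show ?thesis
  proof (cases "2 \<le> card (base \<G>)")
    case True
    obtain S where S: "S \<in> base \<F>" using ne by blast
    have "real (card (base \<G>)) \<le> real ((t + 1) * m)" using card_base_le[OF S] by (simp only: of_nat_le_iff)
    then have "real (card (base \<G>)) \<le> ((real t + 2) - 1) * real m" by (simp add: algebra_simps)
    then have "(real (card (base \<G>)) + real m / (4 * (real t + 2))) * real (N (t+1))
        \<le> (((real t + 2) - 1) * real m + real m / (4 * (real t + 2))) * real (N (t+1))"
      by (intro mult_right_mono add_right_mono) auto
    then have f: "real (card \<F>) \<le> (((real t + 2) - 1) * real m + real m / (4 * (real t + 2))) * real (N (t+1))"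
      using F_real_one[OF ne] by linarith
    have g: "real (card \<G>) \<le> (1 + real m / (2 * (real t + 2)^2)) * real (N (t+1))"
      using sw.F_real_two[OF True] s by simp
    show ?thesis
    proof (rule extremal_I, rule product_bound_single[OF _ _ _ _ _ _ f g])
      show "real m \<le> real M" using M_facts(1) by simp
      show "real t + 2 \<le> real M" using M_facts(2) by linarith
      show "3 \<le> real t + 2" using t_pos by linarith
    qed auto
  next
    case False
    show ?thesis
    proof (rule extremal_I18, rule product_bound_few[OF _ _ _ F_real_one_M[OF ne] sw.F_real_one_M[OF p]])
      show "4 \<le> real M" using M_facts(3) by linarith
      show "real (card (base \<G>)) \<le> 2 * real M - 2" using False M_facts(3) by linarith
      show "real (card (base \<F>)) \<le> 2" using s by simp
    qed auto
  qed
qed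

lemma bound_two_bases:
  assumes s: "card (base \<F>) = 2" and p: "base \<G> \<noteq> {}"
  shows "card \<F> * card \<G> \<le> max ((card (\<A> n k t))^2) ((card (\<H> n k t))^2)"
proof -
  interpret sw: cross_pair n k t \<G> \<F> by (rule swapped)
  have ne: "base \<F> \<noteq> {}" using s by auto
  show ?thesis
  proof (rule extremal_I18, rule product_bound_few[OF _ _ _ F_real_one_M[OF ne] sw.F_real_one_M[OF p]])
    show "4 \<le> real M" using M_facts(3) by linarith
    show "real (card (base \<G>)) \<le> 2 * real M - 2" using card_base_le_two[OF s p] M_facts(3) by linarith
    show "real (card (base \<F>)) \<le> 2" using s by simp
  qed auto
qed

lemma bound_far_pair:
  assumes "T\<^sub>1 \<in> base \<G>" "T\<^sub>2 \<in> base \<G>" "card (T\<^sub>1 \<inter> T\<^sub>2) < t" "3 \<le> card (base \<F>)"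
  shows "card \<F> * card \<G> \<le> max ((card (\<A> n k t))^2) ((card (\<H> n k t))^2)"
proof -
  interpret sw: cross_pair n k t \<G> \<F> by (rule swapped)
  have ne: "base \<F> \<noteq> {}" "base \<G> \<noteq> {}" using assms by auto
  have c: "card (base \<F>) \<le> 4" "card (base \<G>) \<le> 3"
    using base_far_pair[OF assms(1,2,3) ne(1)] assms(4) by auto
  show ?thesis
  proof (rule extremal_I18, rule product_bound_grid[OF _ _ _ F_real_one_M[OF ne(1)] sw.F_real_one_M[OF ne(2)]])
    show "4 \<le> real M" using M_facts(3) by linarith
    show "real (card (base \<G>)) \<le> 3" "real (card (base \<F>)) \<le> 4" using c by linarith+
  qed auto
qed

lemma card_le_A:
  assumes "W \<subseteq> V" "card W = t + 2" "\<And>K. K \<in> \<F> \<Longrightarrow> t + 1 \<le> card (K \<inter> W)"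
  shows "card \<F> \<le> card (\<A> n k t)"
proof -
  have "card \<F> \<le> card {K \<in> nsets V k. t + 1 \<le> card (K \<inter> W)}"
    using assms(3) F_sub by (intro card_mono) (auto simp: finite_imp_finite_nsets)
  then show ?thesis using card_near_all_eq_A[OF assms(1,2)] by simp
qed

text \<open>Compares \<open>\<F>\<close> with \<open>hub\<close> on a scale that balances the two
  families: the possible excess is \<open>t * N (t+2)\<close>, and as soon as
  \<open>base \<G>\<close> lacks a petal, \<open>\<F>\<close> falls short of \<open>hub\<close> by
  at least that amount.\<close>

lemma star_card_bounds:
  assumes D: "D \<subseteq> V" "card D = t" "\<forall>T\<in>base \<G>. D \<subseteq> T" "\<forall>S\<in>base \<F>. D \<subseteq> S"
    and p: "3 \<le> card (base \<G>)" and s: "3 \<le> card (base \<F>)"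
  shows "card \<F> \<le> hub + t * N (t+2)" "card (base \<G>) < m \<Longrightarrow> card \<F> + t * N (t+2) \<le> hub"
    "card (base \<G>) \<le> m" "card (base \<G>) = m \<Longrightarrow> card (base \<F>) = m \<Longrightarrow> card \<F> \<le> hub + t"
proof -
  have ne: "base \<G> \<noteq> {}" "base \<F> \<noteq> {}" using p s by auto
  note sb = star_bound[OF D ne]
  let ?q = "m - card (base \<G>)" and ?d = "N (t+2)"
  have "N (t - 1 + card (base \<F>)) \<le> ?d" using s t_pos by (intro N_mono_le) linarith
  then have le: "card \<F> + ?q * N (t+1) \<le> hub + 2 * (?q * (m * ?d)) + t * ?d"
    using sb(2) mult_le_mono2[of "N (t - 1 + card (base \<F>))" ?d t] by linarith
  \<comment> \<open>The gain \<open>N (t+1)\<close> from a missing petal covers the two error terms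
    of that petal and, twice over, the term for the sets not above \<open>D\<close>.\<close>
  have d: "2 * (m * ?d) + 2 * (t * ?d) \<le> N (t+1)"
  proof -
    have "1 \<le> (t + 2)^2" by simp
    then have "1 * (4 * k) \<le> (t + 2)^2 * (4 * k)" by (rule mult_le_mono1)
    moreover have "2 * m + 2 * t \<le> 4 * k" using m_t k_ge by linarith
    ultimately have "?d * (2 * m + 2 * t) \<le> ?d * (4 * (t + 2)^2 * k)" by (intro mult_le_mono2) linarith
    then show ?thesis using N_decay[of "t+1"] by (simp add: algebra_simps)
  qed
  have q: "2 * (?q * (m * ?d)) + ?q * (2 * (t * ?d)) \<le> ?q * N (t+1)"
    using mult_le_mono2[OF d, of ?q] by (simp add: algebra_simps)
  show "card \<F> \<le> hub + t * ?d" using le q by linarith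
  show "card (base \<G>) \<le> m" by (rule sb(1))
  show "card \<F> + t * ?d \<le> hub" if "card (base \<G>) < m"
  proof -
    have "1 \<le> ?q" using that by simp
    then have "1 * (2 * (t * ?d)) \<le> ?q * (2 * (t * ?d))" by (rule mult_le_mono1)
    then show ?thesis using le q by linarith
  qed
  show "card \<F> \<le> hub + t" if "card (base \<G>) = m" "card (base \<F>) = m"
  proof -
    \<comment> \<open>With all \<open>m\<close> petals present, a set containing
      \<open>D - {d}\<close> and every petal is determined completely, so the last term counts only
      the \<open>t\<close> exceptional sets, as in \<open>\<H> n k t\<close>.\<close>
    have "t - 1 + m = k" using m_t t_pos by linarith
    then show ?thesis using sb(2) that N_k by simp
  qed
qed

lemma bound_star:
  assumes D: "D \<subseteq> V" "card D = t" "\<forall>T\<in>base \<G>. D \<subseteq> T"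
    and p: "3 \<le> card (base \<G>)" and s: "3 \<le> card (base \<F>)"
  shows "card \<F> * card \<G> \<le> (card (\<H> n k t))^2"
proof -
  interpret sw: cross_pair n k t \<G> \<F> by (rule swapped)
  have DF: "\<forall>S\<in>base \<F>. D \<subseteq> S" using star_core_transfer[OF D p] by blast
  note F = star_card_bounds[OF D DF p s] and G = sw.star_card_bounds[OF D(1,2) DF D(3) s p]
  \<comment> \<open>The inequality \<open>(hub - d) * (hub + d) \<le> hub^2\<close>: the shortfall
    of one family compensates the excess of the other.\<close>
  have prod: "f * g \<le> hub^2" if "f + d \<le> hub" "g \<le> hub + d" for f g d :: nat
  proof -
    define a where "a = hub - d"
    have a: "hub = a + d" using that(1) unfolding a_def by linarith
    have "f * g \<le> a * (a + d + d)" using that unfolding a by (intro mult_le_mono) auto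
    also have "\<dots> \<le> hub^2" unfolding a by (simp add: power2_eq_square algebra_simps)
    finally show ?thesis .
  qed
  have hub: "hub^2 \<le> (card (\<H> n k t))^2" using card_H by (intro power_mono) auto
  consider "card (base \<G>) < m" | "card (base \<F>) < m" | "card (base \<G>) = m" "card (base \<F>) = m"
    using F(3) G(3) by linarith
  then show ?thesis
  proof cases
    case 1
    then show ?thesis using prod[OF F(2)[OF 1] G(1)] hub by linarith
  next
    case 2
    then show ?thesis using prod[OF G(2)[OF 2] F(1)] hub unfolding mult.commute[of "card \<F>"] by linarith
  next
    case 3
    then have "card \<F> \<le> card (\<H> n k t)" "card \<G> \<le> card (\<H> n k t)" using F(4) G(4) card_H by auto
    then show ?thesis unfolding power2_eq_square by (rule mult_le_mono)
  qed
qed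

lemma bound_both_bases:
  assumes "base \<F> \<noteq> {}" "base \<G> \<noteq> {}"
  shows "card \<F> * card \<G> \<le> max ((card (\<A> n k t))^2) ((card (\<H> n k t))^2)"
proof -
  interpret sw: cross_pair n k t \<G> \<F> by (rule swapped)
  have pos: "card (base \<F>) \<noteq> 0" "card (base \<G>) \<noteq> 0" using assms by auto
  consider "card (base \<F>) = 1" | "card (base \<F>) = 2" | "card (base \<G>) = 1" | "card (base \<G>) = 2"
    | "3 \<le> card (base \<F>)" "3 \<le> card (base \<G>)" using pos by linarith
  then show ?thesis
  proof cases
    case 1 then show ?thesis using bound_single_base assms by blast
  next
    case 2 then show ?thesis using bound_two_bases assms by blast
  next
    case 3 then show ?thesis using sw.bound_single_base assms by (simp add: mult.commute)
  next
    case 4 then show ?thesis using sw.bound_two_bases assms by (simp add: mult.commute)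
  next
    case 5
    show ?thesis
    proof (cases "\<exists>T\<^sub>1\<in>base \<G>. \<exists>T\<^sub>2\<in>base \<G>. card (T\<^sub>1 \<inter> T\<^sub>2) < t")
      case True
      then show ?thesis using bound_far_pair 5 by blast
    next
      case False
      then have close: "t \<le> card (T \<inter> T')" if "T \<in> base \<G>" "T' \<in> base \<G>" for T T'
        using that by (meson not_le)
      show ?thesis
      proof (cases "\<exists>D. card D = t \<and> (\<forall>T\<in>base \<G>. D \<subseteq> T)")
        case True
        then obtain D where D: "card D = t" "\<forall>T\<in>base \<G>. D \<subseteq> T" by blast
        then have "D \<subseteq> V" using assms(2) baseD by blast
        then show ?thesis using bound_star[OF _ D 5(2,1)] by simp
      next
        case False
        then obtain W where W: "W \<subseteq> V" "card W = t + 2" "\<And>K. K \<in> \<F> \<union> \<G> \<Longrightarrow> t + 1 \<le> card (K \<inter> W)"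
          using nonstar_bases[OF 5(2,1) close] by blast
        have "card \<F> \<le> card (\<A> n k t)" "card \<G> \<le> card (\<A> n k t)"
          using card_le_A[OF W(1,2)] sw.card_le_A[OF W(1,2)] W(3) by auto
        then have "card \<F> * card \<G> \<le> (card (\<A> n k t))^2" unfolding power2_eq_square by (rule mult_le_mono)
        then show ?thesis by simp
      qed
    qed
  qed
qed

text \<open>The case \<open>(a, b) = (1, 2)\<close>. As \<open>base \<G>\<close> is empty, only the
  error term of \<open>\<F>\<close> remains. With two elements in \<open>base \<F>\<close> this
  error has a factor \<open>1 / (t + 2)^2\<close>, which cancels the binomial coefficient in the
  bound for \<open>\<G>\<close>; with one element, \<open>\<G>\<close> is bounded by
  \<open>(1 + m / 8) * N (t+1)\<close>.\<close>

lemma bound_base_empty: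
  assumes S: "base \<F> \<noteq> {}" and T: "transv \<G> T" "card T = t + 2" "\<And>U. transv \<G> U \<Longrightarrow> t + 2 \<le> card U"
    and F1: "\<And>U. transv \<F> U \<Longrightarrow> t + 1 \<le> card U"
  shows "card \<F> * card \<G> \<le> max ((card (\<A> n k t))^2) ((card (\<H> n k t))^2)"
proof -
  interpret sw: cross_pair n k t \<G> \<F> by (rule swapped)
  let ?c = "real (N (t+1))" and ?x = "real t + 2"
  have e: "base \<G> = {}" using T(3) by (fastforce simp: base_def)
  have mM: "real m \<le> real M" using M_facts(1) by simp
  have mc: "(real m * ?c)^2 \<le> (real M * ?c)^2" using mM by (intro power_mono mult_right_mono) auto
  show ?thesis
  proof (rule extremal_I18, cases "2 \<le> card (base \<F>)")
    case True
    have f: "real (card \<F>) \<le> real m / (2 * ?x^2) * ?c" using F_real_two[OF True] e by simp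
    have "card \<G> \<le> ((t + 2) choose t) * (m ^ 1 * N (t + 1))"
      by (rule sw.F_cover_b[OF T(1,2) F1])
    then have "real (card \<G>) \<le> real (((t + 2) choose t) * (m ^ 1 * N (t + 1)))" by (simp only: of_nat_le_iff)
    also have "\<dots> = ?x * (real t + 1) / 2 * (real m * ?c)"
      by (simp only: of_nat_mult choose_two_real power_one_right)
    also have "\<dots> \<le> ?x * ?x / 2 * (real m * ?c)" by (intro mult_right_mono divide_right_mono mult_left_mono) auto
    finally have "real (card \<F>) * real (card \<G>) \<le> (real m / (2 * ?x^2) * ?c) * (?x * ?x / 2 * (real m * ?c))"
      using f by (intro mult_mono) auto
    also have "\<dots> = (real m * ?c)^2 / 4"
    proof -
      have id: "(a / (2 * y^2) * c) * (y * y / 2 * (a * c)) = (a * c)^2 / 4" if "y \<noteq> 0" for a c y :: real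
        using that by (simp add: field_simps power2_eq_square)
      have "?x \<noteq> 0" by linarith
      then show ?thesis by (rule id)
    qed
    finally show "18 * (real (card \<F>) * real (card \<G>)) \<le> 17 * (real M * ?c)^2"
      using mc zero_le_power2[of "real M * ?c"] by linarith
  next
    case False
    have s: "card (base \<F>) \<le> 1" using False by simp
    have f: "real (card \<F>) \<le> real M / 12 * ?c" using F_real_one_M[OF S] e by simp
    have "real (card \<G>) \<le> real (card (base \<F>) * N (t+1) + ((t + 2) choose t) * m * m * N (t+2))"
      using sw.F_cover_t[OF T(1,2)] by (simp only: of_nat_le_iff)
    also have "\<dots> = real (card (base \<F>)) * ?c + real (((t + 2) choose t) * m * m * N (t+2))"
      by (simp only: of_nat_add of_nat_mult)
    also have "\<dots> \<le> 1 * ?c + real m / 8 * ?c" using error_three s by (intro add_mono mult_right_mono) auto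
    also have "\<dots> \<le> real M / 4 * ?c + real M / 8 * ?c"
      using mM M_facts(3) by (intro add_mono mult_right_mono) auto
    finally have "real (card \<F>) * real (card \<G>) \<le> (real M / 12 * ?c) * (real M / 4 * ?c + real M / 8 * ?c)"
      using f by (intro mult_mono) auto
    also have "\<dots> = (real M * ?c)^2 / 32" by (simp add: field_simps power2_eq_square)
    finally show "18 * (real (card \<F>) * real (card \<G>)) \<le> 17 * (real M * ?c)^2"
      using zero_le_power2[of "real M * ?c"] by linarith
  qed
qed

text \<open>Transversals exist since members of \<open>\<G>\<close> are transversals of
  \<open>\<F>\<close>. They have at least \<open>t\<close> elements because they meet a member of
  \<open>\<F>\<close> in that many, and exactly \<open>t\<close> is excluded by
  \<open>nontriv\<close>.\<close>

lemma obtain_min_transversal: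
  obtains a S where "transv \<F> S" "card S = t + a" "1 \<le> a" "\<And>U. transv \<F> U \<Longrightarrow> t + a \<le> card U"
proof -
  have "t \<le> card V" using n_gt t_less by simp
  then obtain U where U: "U \<subseteq> V" "card U = t" by (meson obtain_subset_with_card_n)
  \<comment> \<open>For an empty family every \<open>t\<close>-subset of \<open>V\<close> would be a
    transversal, against \<open>nontriv\<close>.\<close>
  have "\<F> \<noteq> {}" "\<G> \<noteq> {}" using nontriv[OF U(2)] U(1) unfolding transv_def by auto
  then obtain G F where GF: "G \<in> \<G>" "F \<in> \<F>" by blast
  have ge: "t + 1 \<le> card U" if U: "transv \<F> U" for U
  proof -
    have "t \<le> card (U \<inter> F)" using U GF(2) unfolding transv_def by blast
    also have "\<dots> \<le> card U" using U finite_subset_V unfolding transv_def by (intro card_mono) auto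
    finally have "t \<le> card U" .
    moreover have "card U \<noteq> t" using nontriv U by blast
    ultimately show ?thesis by simp
  qed
  define P where "P j = (\<exists>S. transv \<F> S \<and> card S = j)" for j
  have "P (card G)" unfolding P_def using G_eq GF(1) by blast
  then have PL: "P (Least P)" by (rule LeastI)
  then obtain S where S: "transv \<F> S" "card S = Least P" unfolding P_def by blast
  have min: "Least P \<le> card U" if "transv \<F> U" for U
    using that by (intro Least_le) (auto simp: P_def)
  show thesis
  proof (rule that[OF S(1), of "Least P - t"])
    show "card S = t + (Least P - t)" "1 \<le> Least P - t" using ge[OF S(1)] S(2) by linarith+
    show "t + (Least P - t) \<le> card U" if "transv \<F> U" for U
      using min[OF that] ge[OF S(1)] S(2) by linarith
  qed
qed

theorem product_bound:
  "card \<F> * card \<G> \<le> max ((card (\<A> n k t))^2) ((card (\<H> n k t))^2)"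
proof -
  interpret sw: cross_pair n k t \<G> \<F> by (rule swapped)
  obtain a S where a: "transv \<F> S" "card S = t + a" "1 \<le> a" "\<And>U. transv \<F> U \<Longrightarrow> t + a \<le> card U"
    using obtain_min_transversal by blast
  obtain b T where b: "transv \<G> T" "card T = t + b" "1 \<le> b" "\<And>U. transv \<G> U \<Longrightarrow> t + b \<le> card U"
    using sw.obtain_min_transversal by blast
  have "card \<F> * card \<G> \<le> (((t + a) choose t) * (m ^ b * N (t + b))) * (((t + b) choose t) * (m ^ a * N (t + a)))"
    using F_cover_b[OF a(1,2) b(4)] sw.F_cover_b[OF b(1,2) a(4)] by (rule mult_le_mono)
  \<comment> \<open>Each single bound mixes \<open>a\<close> and \<open>b\<close>; exchanging the
    factors \<open>m ^ b * N (t + b)\<close> and \<open>m ^ a * N (t + a)\<close> separates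
    them.\<close>
  also have "\<dots> = \<phi> a * \<phi> b" unfolding \<phi>_def by (simp add: ac_simps)
  finally have phi: "card \<F> * card \<G> \<le> \<phi> a * \<phi> b" .
  have mc: "(real m * real (N (t+1)))^2 \<le> (real M * real (N (t+1)))^2"
    using M_facts(1) by (intro power_mono mult_right_mono) auto
  have small: ?thesis if "real (\<phi> a) * real (\<phi> b) \<le> (real m * real (N (t+1)))^2 / 2"
  proof (rule extremal_I18)
    have "real (card \<F> * card \<G>) \<le> real (\<phi> a * \<phi> b)" using phi by (simp only: of_nat_le_iff)
    then have "real (card \<F>) * real (card \<G>) \<le> (real M * real (N (t+1)))^2 / 2"
      using that mc unfolding of_nat_mult by linarith
    then show "18 * (real (card \<F>) * real (card \<G>)) \<le> 17 * (real M * real (N (t+1)))^2"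
      using zero_le_power2[of "real M * real (N (t+1))"] by linarith
  qed
  have two: "real (\<phi> j) \<le> real m / 8 * real (N (t+1))" if "2 \<le> j" for j
  proof -
    have "real (\<phi> j) \<le> real (\<phi> 2)" using phi_mono[OF that] by (simp only: of_nat_le_iff)
    then show ?thesis using phi_two by linarith
  qed
  have three: "real (\<phi> i) * real (\<phi> j) \<le> (real m * real (N (t+1)))^2 / 2" if "1 \<le> i" "3 \<le> j" for i j
  proof -
    have "real (\<phi> i) * real (\<phi> j) \<le> real (\<phi> 1) * real (\<phi> 3)"
      using phi_mono[OF that(1)] phi_mono[OF that(2)] by (intro mult_mono) auto
    then show ?thesis using phi_one_three by linarith
  qed
  consider "2 \<le> a" "2 \<le> b" | "3 \<le> b" | "3 \<le> a" | "a = 1" "b = 1" | "a = 1" "b = 2" | "a = 2" "b = 1"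
    using a(3) b(3) by linarith
  then show ?thesis
  proof cases
    case 1
    have "real (\<phi> a) * real (\<phi> b) \<le> (real m / 8 * real (N (t+1))) * (real m / 8 * real (N (t+1)))"
      using two[OF 1(1)] two[OF 1(2)] by (intro mult_mono) auto
    also have "\<dots> \<le> (real m * real (N (t+1)))^2 / 2" by (simp add: power2_eq_square)
    finally show ?thesis by (rule small)
  next
    case 2
    then show ?thesis using three[OF a(3)] small by blast
  next
    case 3
    then show ?thesis using three[OF b(3)] small by (simp add: mult.commute)
  next
    case 4
    then have "S \<in> base \<F>" "T \<in> base \<G>" using a b by (auto simp: base_def)
    then show ?thesis using bound_both_bases by blast
  next
    case 5
    then have "S \<in> base \<F>" using a by (auto simp: base_def)
    then show ?thesis using bound_base_empty[of T] a b 5 by blast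
  next
    case 6
    then have "T \<in> base \<G>" using b by (auto simp: base_def)
    then have "card \<G> * card \<F> \<le> max ((card (\<A> n k t))^2) ((card (\<H> n k t))^2)"
      using sw.bound_base_empty[of S] a b 6 by blast
    then show ?thesis by (simp add: mult.commute)
  qed
qed

end

section \<open>Reduction to saturated families\<close>

theorem theorem1p3:
  fixes n k t :: nat and \<F> \<G> :: "nat set set"
  assumes "0 < t" and "t < k" and "k < n"
    and "n \<ge> 4 * (t + 2)^2 * k^2" and "k \<ge> 5"
    and "\<F> \<subseteq> nsets {1..n} k" and "\<G> \<subseteq> nsets {1..n} k"
    and "nontrivial_cross_intersecting n t \<F> \<G>"
  shows "card \<F> * card \<G> \<le> max ((card (\<A> n k t))^2) ((card (\<H> n k t))^2)"
proof -
  interpret cross_params n k t using assms by unfold_locales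
  have sub: "\<F> \<subseteq> nsets V k" "\<G> \<subseteq> nsets V k" using assms unfolding V_def by auto
  have cross: "t \<le> card (F \<inter> G)" if "F \<in> \<F>" "G \<in> \<G>" for F G
    using assms(8) that unfolding nontrivial_cross_intersecting_def cross_intersecting_def by blast
  \<comment> \<open>A transversal with only \<open>t\<close> elements lies inside every member,
    hence in the common intersection, which has fewer than \<open>t\<close> elements.\<close>
  have nontriv: "\<not> transv \<K> U" if "\<K> \<subseteq> nsets V k" "card (V \<inter> \<Inter>\<K>) < t" "card U = t" for \<K> U
  proof
    assume U: "transv \<K> U"
    then have UV: "U \<subseteq> V" "finite U" unfolding transv_def using finite_subset_V by auto
    have "U \<subseteq> K" if "K \<in> \<K>" for K
    proof -
      have "card U \<le> card (U \<inter> K)" using U that \<open>card U = t\<close> unfolding transv_def by auto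
      then have "U \<inter> K = U" using UV by (intro card_seteq) auto
      then show ?thesis by blast
    qed
    then have "U \<subseteq> V \<inter> \<Inter>\<K>" using UV by blast
    then have "card U \<le> card (V \<inter> \<Inter>\<K>)" by (intro card_mono) auto
    then show False using that by simp
  qed
  \<comment> \<open>Enlarging a family can only destroy transversals, so non-triviality survives the
    saturation.\<close>
  have anti: "transv \<K> U" if "transv \<L> U" "\<K> \<subseteq> \<L>" for \<K> \<L> U
    using that unfolding transv_def by blast
  text \<open>Replacing each family by the \<open>k\<close>-sets compatible with the other one is a Galois closure.\<close>
  define \<F>' where "\<F>' = {K \<in> nsets V k. transv \<G> K}"
  define \<G>' where "\<G>' = {K \<in> nsets V k. transv \<F>' K}"
  have FF: "\<F> \<subseteq> \<F>'" using sub cross unfolding \<F>'_def transv_def by (auto simp: nsets_def)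
  have GG: "\<G> \<subseteq> \<G>'"
  proof
    fix G assume G: "G \<in> \<G>"
    then have "G \<in> nsets V k" "G \<subseteq> V" using sub by (auto simp: nsets_def)
    moreover have "t \<le> card (G \<inter> K)" if "K \<in> \<F>'" for K
      using that G unfolding \<F>'_def transv_def by (auto simp: Int_commute)
    ultimately show "G \<in> \<G>'" unfolding \<G>'_def transv_def by blast
  qed
  have "\<F>' = {K \<in> nsets V k. transv \<G>' K}"
  proof (intro equalityI subsetI)
    fix K assume K: "K \<in> \<F>'"
    then have "t \<le> card (K \<inter> G)" if "G \<in> \<G>'" for G
      using that unfolding \<G>'_def transv_def by (auto simp: Int_commute)
    then show "K \<in> {K \<in> nsets V k. transv \<G>' K}" using K unfolding \<F>'_def transv_def by blast
  next
    fix K assume "K \<in> {K \<in> nsets V k. transv \<G>' K}"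
    then show "K \<in> \<F>'" unfolding \<F>'_def using anti[OF _ GG] by blast
  qed
  moreover have "\<not> transv \<F>' U \<and> \<not> transv \<G>' U" if "card U = t" for U
    using nontriv[OF sub(1) _ that] nontriv[OF sub(2) _ that] anti[OF _ FF] anti[OF _ GG] assms(8)
    unfolding nontrivial_cross_intersecting_def V_def by blast
  ultimately interpret cross_pair n k t \<F>' \<G>'
    using \<G>'_def by unfold_locales auto
  interpret sw: cross_pair n k t \<G>' \<F>' by (rule swapped)
  have "card \<F> * card \<G> \<le> card \<F>' * card \<G>'"
    using FF GG by (intro mult_le_mono card_mono) auto
  then show ?thesis using product_bound by linarith
qed

end
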